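(* Let $p$ be an odd prime, let $n,k$ be positive integers, and let $f\in\mathcal{GB}_n^{p^k}$ be a gbent function given as $f(\mathbf{x})=\sum_{i=0}^{k-1}p^ia_i(\mathbf{x})$ for functions $a_i:\mathbb{Z}_p^n\to\mathbb{Z}_p$, $0\le i\le k-1$. Then the dual $f^{\ast}\in\mathcal{GB}_n^{p^k}$ of $f$ is given by $f^{\ast}(\mathbf{x})=\sum_{i=0}^{k-1}p^ib_i(\mathbf{x})$, where $b_i:\mathbb{Z}_p^n\to\mathbb{Z}_p$ are $$b_{k-1}(\mathbf{x})=a_{k-1}^{\ast}(\mathbf{x}),\qquad b_j(\mathbf{x})=(a_{k-1}+a_j)^{\ast}(\mathbf{x})-a_{k-1}^{\ast}(\mathbf{x}),\quad 0\le j\le k-2.$$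
   Context: $\mathbb{Z}_m$ is the ring of integers modulo $m$, and $\zeta_m=e^{2\pi\sqrt{-1}/m}$. $\mathcal{GB}_n^{p^r}$ is the set of all functions $\mathbb{Z}_p^n\to\mathbb{Z}_{p^r}$. For $F\in\mathcal{GB}_n^{p^r}$ the generalized Walsh-Hadamard transform is $\mathcal{H}_F(\mathbf{u})=p^{-n/2}\sum_{\mathbf{x}\in\mathbb{Z}_p^n}\zeta_p^{-\mathbf{u}\cdot\mathbf{x}}\zeta_{p^r}^{F(\mathbf{x})}$; $F$ is gbent if $|\mathcal{H}_F(\mathbf{u})|=1$ for all $\mathbf{u}\in\mathbb{Z}_p^n$. It is known that for every gbent $F\in\mathcal{GB}_n^{p^r}$ there is a (unique) function $F^{\ast}:\mathbb{Z}_p^n\to\mathbb{Z}_{p^r}$ such that for every $\mathbf{u}$, $\mathcal{H}_F(\mathbf{u})=\pm\zeta_{p^r}^{F^{\ast}(\mathbf{u})}$ if $n$ is even or $n$ is odd and $p\equiv 1\pmod 4$, and $\mathcal{H}_F(\mathbf{u})=\pm\sqrt{-1}\,\zeta_{p^r}^{F^{\ast}(\mathbf{u})}$ if $n$ is odd and $p\equiv 3\pmod 4$, where the sign may depend on $\mathbf{u}$. This $F^{\ast}$ is called the dual of $F$ (it need not itself be gbent). When $f=\sum_{i=0}^{k-1}p^ia_i$ is gbent, all component functions $a_{k-1}+\sum_{i=0}^{k-2}c_ia_i$ ($c_i\in\mathbb{Z}_p$) are gbent in $\mathcal{GB}_n^{p}$, so the duals $a_{k-1}^{\ast}$ and $(a_{k-1}+a_j)^{\ast}$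 (functions $\mathbb{Z}_p^n\to\mathbb{Z}_p$) are defined by the case $r=1$. The formula for $b_j$ is computed in $\mathbb{Z}_p$; in expansions $\sum p^ia_i(\mathbf{x})$, $\sum p^ib_i(\mathbf{x})$ elements of $\mathbb{Z}_p$ are identified with their representatives in $\{0,\dots,p-1\}$. *)

theory Defs
  imports Complex_Main "HOL-Number_Theory.Residues"
begin

text \<open>
  The ring of integers modulo \<open>m\<close> is the library's \<^const>\<open>residue_ring\<close>, whose carrier is the set of
  integer representatives from \<open>0\<close> to \<open>m - 1\<close>. Functions on a carrier set are
  extensional (\<^const>\<open>PiE\<close>), so that equality of functions means agreement on the domain.
\<close>

definition Zvec :: "nat \<Rightarrow> nat \<Rightarrow> (nat \<Rightarrow> int) set" where
  "Zvec p n = {..<n} \<rightarrow>\<^sub>E carrier (residue_ring (int p))"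

definition GB :: "nat \<Rightarrow> nat \<Rightarrow> nat \<Rightarrow> ((nat \<Rightarrow> int) \<Rightarrow> int) set" where
  "GB p n r = Zvec p n \<rightarrow>\<^sub>E carrier (residue_ring (int (p ^ r)))"

definition zeta :: "nat \<Rightarrow> complex" where
  "zeta m = exp (2 * complex_of_real pi * \<i> / of_nat m)"

text \<open>
  The inner product is taken over the integer representatives; this is harmless because
  \<open>zeta p powi m\<close> depends only on the residue class of \<open>m\<close> modulo \<open>p\<close>.
\<close>

definition walsh_hadamard ::
  "nat \<Rightarrow> nat \<Rightarrow> nat \<Rightarrow> ((nat \<Rightarrow> int) \<Rightarrow> int) \<Rightarrow> (nat \<Rightarrow> int) \<Rightarrow> complex" where
  "walsh_hadamard p n r F u =
     complex_of_real (real p powr (- real n / 2)) *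
     (\<Sum>x\<in>Zvec p n. zeta p powi (- (\<Sum>i<n. u i * x i)) * zeta (p ^ r) powi F x)"

definition gbent :: "nat \<Rightarrow> nat \<Rightarrow> nat \<Rightarrow> ((nat \<Rightarrow> int) \<Rightarrow> int) \<Rightarrow> bool" where
  "gbent p n r F \<longleftrightarrow> F \<in> GB p n r \<and> (\<forall>u\<in>Zvec p n. cmod (walsh_hadamard p n r F u) = 1)"

text \<open>The sign \<open>s\<close> may depend on the point \<open>u\<close>.\<close>

definition is_dual ::
  "nat \<Rightarrow> nat \<Rightarrow> nat \<Rightarrow> ((nat \<Rightarrow> int) \<Rightarrow> int) \<Rightarrow> ((nat \<Rightarrow> int) \<Rightarrow> int) \<Rightarrow> bool" where
  "is_dual p n r F G \<longleftrightarrow> G \<in> GB p n r \<and>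
     (\<forall>u\<in>Zvec p n. \<exists>s\<in>{1, -1}.
        walsh_hadamard p n r F u =
          s * (if odd n \<and> [p = 3] (mod 4) then \<i> else 1) * zeta (p ^ r) powi G u)"

text \<open>
  For \<open>p\<close> an odd prime and \<open>F\<close> gbent there is exactly one dual; only in that case is the
  following description meaningful.
\<close>

definition dual :: "nat \<Rightarrow> nat \<Rightarrow> nat \<Rightarrow> ((nat \<Rightarrow> int) \<Rightarrow> int) \<Rightarrow> (nat \<Rightarrow> int) \<Rightarrow> int" where
  "dual p n r F = (THE G. is_dual p n r F G)"

end

theory Submission
  imports Defs "HOL-Computational_Algebra.Polynomial"
begin

text \<open>
  Write \<open>N = p^k\<close> and \<open>q = p^(k-1)\<close>, let \<open>\<zeta>\<close> be the standard primitive \<open>N\<close>-th root of unity and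
  \<open>\<omega> = \<zeta>^q\<close> the standard primitive \<open>p\<close>-th root of unity. Multiplied by \<open>p^(n/2)\<close>, a Walsh coefficient of
  \<open>f\<close> becomes an element \<open>S\<close> of \<open>\<int>[\<zeta>]\<close>, and everything follows from the arithmetic of this ring.

  The dual exists because an element \<open>S\<close> with \<open>S * cnj S = p^n\<close> is determined up to sign and a power of
  \<open>\<zeta>\<close> (lemma \<open>equal_norm_associates\<close>). Indeed, \<open>p\<close> is associated to a power of the prime \<open>\<pi> = 1 - \<zeta>\<close>, which
  complex conjugation only changes by a unit; so any two such elements \<open>S\<close> and \<open>E\<close> contain the same power of
  \<open>\<pi>\<close>, and \<open>S * cnj E\<close> is \<open>p^n\<close> times an element \<open>V\<close> of \<open>\<int>[\<zeta>]\<close> of absolute value \<open>1\<close>. Comparing the trace of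
  \<open>V * cnj V\<close>, a quadratic form in the coefficients of \<open>V\<close>, with its least positive values shows that
  \<open>V\<close> is plus or minus a power of \<open>\<zeta>\<close>. For \<open>E\<close> one takes \<open>\<eta>^n\<close>, where \<open>\<eta>\<close> is a square root of
  \<open>p\<close> or \<open>-p\<close> inside \<open>\<int>[\<omega>]\<close>; this is where the factor \<open>\<i>\<close> for odd \<open>n\<close> and \<open>p\<close> congruent to \<open>3\<close> modulo \<open>4\<close>
  comes from.

  The formula for the dual comes from lemma \<open>dual_component\<close>. Split \<open>f = q * h + r\<close> with
  \<open>0 \<le> r < q\<close> and collect the terms of the Walsh sum with \<open>r = d\<close> into an element \<open>T d\<close> of \<open>\<int>[\<omega>]\<close>, so that
  \<open>S\<close> is the sum of all \<open>\<zeta>^d * T d\<close>. The powers \<open>\<zeta>^d\<close> with \<open>d < q\<close> are linearly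
  independent over \<open>\<int>[\<omega>]\<close>, and \<open>S\<close> is an element of \<open>\<int>[\<omega>]\<close> times \<open>\<zeta>^G\<close>, where \<open>G\<close> is the value of the dual. So
  only one \<open>T d\<close> is nonzero, the one with \<open>d = G mod q\<close>, and it is known exactly. Replacing the weights
  \<open>\<zeta>^d\<close> by \<open>\<omega>^(e d)\<close> gives the Walsh coefficients of all functions \<open>h + e(r)\<close> with values modulo \<open>p\<close>, and
  shows that their dual arises from \<open>G\<close> by the same operation. With \<open>e = 0\<close> and with \<open>e\<close> the \<open>j\<close>-th digit
  in base \<open>p\<close> this reads off the digits of \<open>G\<close>.
\<close>

section \<open>The ring of integer polynomials in a complex number\<close>

definition ipoly :: "int poly \<Rightarrow> complex \<Rightarrow> complex" where
  "ipoly P w = poly (map_poly of_int P) w"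

lemma ipoly_0 [simp]: "ipoly 0 w = 0"
  by (simp add: ipoly_def)

lemma ipoly_pCons [simp]: "ipoly (pCons a P) w = of_int a + w * ipoly P w"
  by (cases "a = 0 \<and> P = 0") (auto simp: ipoly_def map_poly_pCons)

lemma ipoly_add: "ipoly (P + Q) w = ipoly P w + ipoly Q w"
  by (induction P Q rule: poly_induct2) (auto simp: algebra_simps)

lemma ipoly_smult: "ipoly (smult a P) w = of_int a * ipoly P w"
  by (induction P) (auto simp: algebra_simps)

lemma ipoly_diff: "ipoly (P - Q) w = ipoly P w - ipoly Q w"
  using ipoly_add[of "P - Q" Q w] by simp

lemma ipoly_mult: "ipoly (P * Q) w = ipoly P w * ipoly Q w"
  by (induction P) (auto simp: algebra_simps ipoly_add ipoly_smult)

lemma ipoly_pcompose: "ipoly (pcompose P Q) w = ipoly P (ipoly Q w)"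
  by (induction P) (auto simp: pcompose_pCons ipoly_add ipoly_mult)

lemma ipoly_altdef: "ipoly P w = (\<Sum>i\<le>degree P. of_int (coeff P i) * w ^ i)"
  unfolding ipoly_def by (simp add: poly_altdef degree_map_poly coeff_map_poly)

lemma ipoly_sum_monom:
  "ipoly (\<Sum>i\<in>A. Polynomial.monom (c i) (m i)) w = (\<Sum>i\<in>A. of_int (c i) * w ^ m i)"
proof -
  have monom: "ipoly (Polynomial.monom a e) w = of_int a * w ^ e" for a e
    by (induction e) (auto simp: monom_0 monom_Suc)
  show ?thesis
    by (induction A rule: infinite_finite_induct) (auto simp: ipoly_add monom)
qed

text \<open>
  The ring \<open>\<int>[w]\<close>.
\<close>
definition Zadj :: "complex \<Rightarrow> complex set" where
  "Zadj w = range (\<lambda>P. ipoly P w)"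

lemma ipoly_in_Zadj [simp, intro]: "ipoly P w \<in> Zadj w"
  by (auto simp: Zadj_def)

lemma Zadj_of_int [simp, intro]: "of_int a \<in> Zadj w"
  using ipoly_in_Zadj[of "[:a:]" w] by simp

lemma Zadj_0 [simp, intro]: "0 \<in> Zadj w"
  using Zadj_of_int[of 0 w] by simp

lemma Zadj_1 [simp, intro]: "1 \<in> Zadj w"
  using Zadj_of_int[of 1 w] by simp

lemma Zadj_gen [simp, intro]: "w \<in> Zadj w"
  using ipoly_in_Zadj[of "[:0, 1:]" w] by simp

lemma Zadj_add [intro]: "x \<in> Zadj w \<Longrightarrow> y \<in> Zadj w \<Longrightarrow> x + y \<in> Zadj w"
  by (auto simp: Zadj_def simp flip: ipoly_add)

lemma Zadj_diff [intro]: "x \<in> Zadj w \<Longrightarrow> y \<in> Zadj w \<Longrightarrow> x - y \<in> Zadj w"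
  by (auto simp: Zadj_def simp flip: ipoly_diff)

lemma Zadj_uminus [intro]: "x \<in> Zadj w \<Longrightarrow> - x \<in> Zadj w"
  using Zadj_diff[OF Zadj_0] by fastforce

lemma Zadj_mult [intro]: "x \<in> Zadj w \<Longrightarrow> y \<in> Zadj w \<Longrightarrow> x * y \<in> Zadj w"
  by (auto simp: Zadj_def simp flip: ipoly_mult)

lemma Zadj_power [intro]: "x \<in> Zadj w \<Longrightarrow> x ^ m \<in> Zadj w"
  by (induction m) auto

lemma Zadj_sum [intro]: "(\<And>i. i \<in> A \<Longrightarrow> f i \<in> Zadj w) \<Longrightarrow> sum f A \<in> Zadj w"
  by (induction A rule: infinite_finite_induct) auto

lemma Zadj_prod [intro]: "(\<And>i. i \<in> A \<Longrightarrow> f i \<in> Zadj w) \<Longrightarrow> prod f A \<in> Zadj w"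
  by (induction A rule: infinite_finite_induct) auto

lemma Zadj_trans: "x \<in> Zadj y \<Longrightarrow> y \<in> Zadj w \<Longrightarrow> x \<in> Zadj w"
  by (auto simp: Zadj_def simp flip: ipoly_pcompose)

lemma power_mod_root_of_unity:
  fixes w :: "'a::comm_monoid_mult"
  assumes "w ^ N = 1"
  shows "w ^ (i mod N) = w ^ i"
proof -
  have "w ^ i = w ^ (N * (i div N) + i mod N)" by simp
  also have "\<dots> = w ^ (i mod N)" unfolding power_add power_mult assms by simp
  finally show ?thesis by simp
qed

text \<open>
  Exponents may be reduced modulo \<open>N\<close>; the representation is not unique.
\<close>
lemma Zadj_rep:
  assumes w: "w ^ N = 1" and N: "N > 0" and x: "x \<in> Zadj w"
  obtains c :: "nat \<Rightarrow> int" where "x = (\<Sum>j<N. of_int (c j) * w ^ j)"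
proof -
  obtain P where P: "x = ipoly P w" using x by (auto simp: Zadj_def)
  define c where "c j = (\<Sum>i\<in>{i\<in>{..degree P}. i mod N = j}. coeff P i)" for j
  have "(\<Sum>j<N. of_int (c j) * w ^ j) =
      (\<Sum>j<N. \<Sum>i\<in>{i\<in>{..degree P}. i mod N = j}. of_int (coeff P i) * w ^ i)"
    unfolding c_def of_int_sum sum_distrib_right
    by (intro sum.cong refl) (auto simp: power_mod_root_of_unity[OF w])
  also have "\<dots> = (\<Sum>i\<le>degree P. of_int (coeff P i) * w ^ i)"
    using N by (intro sum.group) auto
  finally show ?thesis by (intro that[of c]) (simp add: P ipoly_altdef)
qed

text \<open>
  This takes the place of the fact that rational algebraic integers are integers. Let \<open>\<mu>\<close> be a nonzero
  integer polynomial of least degree vanishing at \<open>w\<close>, with leading coefficient \<open>l\<close>. Since \<open>\<int>[w]\<close> is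
  spanned by \<open>w^j\<close> with \<open>j < N\<close>, the fixed integer \<open>l^N\<close> turns every element of \<open>\<int>[w]\<close> into an integer
  combination of the powers below the degree of \<open>\<mu>\<close>. If \<open>a\<close> has an inverse \<open>x\<close> in \<open>\<int>[w]\<close>, this applied
  to \<open>x^M\<close> and the minimality of \<open>\<mu>\<close> give that \<open>a^M\<close> divides \<open>l^N\<close>, for every \<open>M\<close>.
\<close>
lemma not_inverse_int_in_Zadj:
  assumes w: "w ^ N = 1" and N: "N > 0" and x: "x \<in> Zadj w" and a: "of_int a * x = 1"
  shows "\<bar>a\<bar> = 1"
proof (rule ccontr)
  assume a1: "\<bar>a\<bar> \<noteq> 1"
  from a have "a \<noteq> 0" by auto
  with a1 have a2: "\<bar>a\<bar> \<ge> 2" by linarith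
  define K where "K = {P :: int poly. P \<noteq> 0 \<and> ipoly P w = 0}"
  have "Polynomial.monom 1 N - 1 \<in> K"
  proof -
    have "ipoly (Polynomial.monom 1 N) w = w ^ N"
      using ipoly_sum_monom[of "\<lambda>_. 1" "\<lambda>_. N" "{()}" w] by simp
    moreover have "ipoly 1 w = 1" using ipoly_pCons[of 1 0 w] by (simp add: one_pCons)
    moreover have "Polynomial.coeff (Polynomial.monom 1 N - 1 :: int poly) N = 1"
      using N by (auto simp: one_pCons coeff_pCons split: nat.splits)
    hence "Polynomial.monom 1 N - 1 \<noteq> (0 :: int poly)" by (metis coeff_0 zero_neq_one)
    ultimately show ?thesis using w by (auto simp: K_def ipoly_diff)
  qed
  then obtain \<mu> where \<mu>: "\<mu> \<in> K" and min: "\<And>P. P \<in> K \<Longrightarrow> degree \<mu> \<le> degree P"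
    using ex_has_least_nat[of "\<lambda>P. P \<in> K" _ degree] by blast
  define m where "m = degree \<mu>"
  define l where "l = lead_coeff \<mu>"
  have l0: "l \<noteq> 0" using \<mu> by (auto simp: l_def K_def)
  have m0: "m > 0"
  proof (rule ccontr)
    assume "\<not> m > 0"
    then obtain c where "\<mu> = [:c:]" by (metis degree_eq_zeroE m_def neq0_conv)
    thus False using \<mu> by (auto simp: K_def)
  qed
  have red: "\<exists>R. degree R < m \<and> of_int (l ^ j) * w ^ j = ipoly R w" for j
  proof (induction j)
    case 0
    show ?case using m0 by (intro exI[of _ "[:1:]"]) auto
  next
    case (Suc j)
    then obtain R where R: "degree R < m" "of_int (l ^ j) * w ^ j = ipoly R w" by blast
    \<comment> \<open>pseudo-division of \<open>x * R\<close> by \<open>\<mu>\<close>: the coefficients of \<open>x^m\<close> cancel\<close>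
    define R' where "R' = smult l (pCons 0 R) - smult (coeff (pCons 0 R) m) \<mu>"
    have "degree (pCons 0 R) \<le> m"
      using R(1) degree_pCons_le[of 0 R] by linarith
    hence "degree R' \<le> m"
      unfolding R'_def m_def by (intro degree_diff_le) (auto intro: order.trans[OF degree_smult_le])
    moreover have "coeff R' m = 0" by (auto simp: R'_def l_def m_def coeff_pCons split: nat.splits)
    ultimately have "degree R' < m" using m0
      by (metis coeff_0_degree_minus_1 eq_zero_or_degree_less degree_0)
    moreover have "ipoly R' w = of_int (l ^ Suc j) * w ^ Suc j"
      using \<mu> R(2) by (simp add: R'_def ipoly_diff ipoly_smult K_def flip: R(2))
    ultimately show ?case by metis
  qed
  define L where "L = l ^ N"
  have bound: "a ^ M dvd L" for M
  proof -
    obtain c where c: "x ^ M = (\<Sum>j<N. of_int (c j) * w ^ j)"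
      using Zadj_rep[OF w N Zadj_power[OF x]] by blast
    obtain R where R: "\<And>j. degree (R j) < m" "\<And>j. of_int (l ^ j) * w ^ j = ipoly (R j) w"
      using red by metis
    define Q where "Q = (\<Sum>j<N. smult (c j * l ^ (N - j)) (R j))"
    have dQ: "degree Q < m" unfolding Q_def using m0 R(1)
      by (intro degree_sum_less) (auto intro: le_less_trans[OF degree_smult_le])
    have ipoly_sum: "ipoly (\<Sum>j\<in>A. f j) w = (\<Sum>j\<in>A. ipoly (f j) w)" for A and f :: "nat \<Rightarrow> int poly"
      by (induction A rule: infinite_finite_induct) (auto simp: ipoly_add)
    have "ipoly Q w = (\<Sum>j<N. of_int L * (of_int (c j) * w ^ j))"
      unfolding Q_def ipoly_sum ipoly_smult R(2)[symmetric] L_def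
    proof (intro sum.cong refl)
      fix j assume "j \<in> {..<N}"
      hence "l ^ N = l ^ (N - j) * l ^ j" by (simp flip: power_add)
      thus "of_int (c j * l ^ (N - j)) * (of_int (l ^ j) * w ^ j) = of_int (l ^ N) * (of_int (c j) * w ^ j)"
        by simp
    qed
    also have "\<dots> = of_int L * x ^ M" by (simp add: c sum_distrib_left)
    finally have "ipoly Q w = of_int L * x ^ M" .
    hence "of_int (a ^ M) * ipoly Q w = of_int L * (of_int a * x) ^ M"
      by (simp add: power_mult_distrib)
    hence "ipoly (smult (a ^ M) Q - [:L:]) w = 0"
      by (simp add: ipoly_diff ipoly_smult a)
    moreover have "degree (smult (a ^ M) Q - [:L:]) < m"
      using dQ m0 by (intro degree_diff_less) (auto intro: le_less_trans[OF degree_smult_le])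
    ultimately have "smult (a ^ M) Q = [:L:]"
      using min[of "smult (a ^ M) Q - [:L:]"] by (force simp: K_def m_def)
    hence "a ^ M * coeff Q 0 = L" by (metis coeff_pCons_0 coeff_smult)
    thus ?thesis by (metis dvd_triv_left)
  qed
  have "L \<noteq> 0" using l0 by (simp add: L_def)
  have "\<bar>a\<bar> ^ nat \<bar>L\<bar> \<le> \<bar>L\<bar>"
    using dvd_imp_le_int[OF \<open>L \<noteq> 0\<close> bound] by (simp add: power_abs)
  moreover have "int (2 ^ nat \<bar>L\<bar>) \<le> \<bar>a\<bar> ^ nat \<bar>L\<bar>"
    using power_mono[OF a2, of "nat \<bar>L\<bar>"] by simp
  moreover have "int (nat \<bar>L\<bar>) < int (2 ^ nat \<bar>L\<bar>)"
    by (subst of_nat_less_iff) (rule less_exp)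
  ultimately show False by linarith
qed

text \<open>
  By Bezout, an integer prime to \<open>p\<close> and divisible by \<open>p\<close> in \<open>\<int>[w]\<close> would make \<open>p\<close> a unit.
\<close>
lemma prime_dvd_int_of_Zadj:
  assumes w: "w ^ N = 1" and N: "N > 0" and p: "prime p"
    and x: "x \<in> Zadj w" and eq: "of_int a = of_nat p * x"
  shows "int p dvd a"
proof (rule ccontr)
  assume "\<not> int p dvd a"
  hence "coprime (int p) a" using p by (simp add: prime_imp_coprime)
  then obtain s t where st: "s * int p + t * a = 1"
    by (metis bezout_int coprime_iff_gcd_eq_1)
  have "of_int (int p) * (of_int s + of_int t * x) = (of_int (s * int p + t * a) :: complex)"
    by (simp add: algebra_simps eq)
  hence "of_int (int p) * (of_int s + of_int t * x) = 1" by (simp add: st)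
  hence "\<bar>int p\<bar> = 1"
    by (rule not_inverse_int_in_Zadj[OF w N, rotated]) (use x in auto)
  with p show False by auto
qed

section \<open>Roots of unity of odd prime power order\<close>

lemma zeta_conv_cis: "zeta m = cis (2 * pi / real m)"
  by (simp add: zeta_def cis_conv_exp mult_ac)

lemma zeta_power_conv_cis: "zeta m ^ j = cis (2 * pi * real j / real m)"
  by (simp add: zeta_conv_cis DeMoivre mult_ac)

lemma zeta_nonzero [simp]: "zeta m \<noteq> 0"
  by (simp add: zeta_def)

lemma zeta_power_self [simp]: "m > 0 \<Longrightarrow> zeta m ^ m = 1"
  using bij_betwE[OF bij_betw_roots_unity[of m]] by (simp add: zeta_power_conv_cis)

lemma zeta_power_inj: "m > 0 \<Longrightarrow> inj_on (\<lambda>j. zeta m ^ j) {..<m}"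
  using bij_betw_imp_inj_on[OF bij_betw_roots_unity[of m]] by (simp add: zeta_power_conv_cis)

lemma zeta_power_eq_1_iff:
  assumes "m > 0"
  shows "zeta m ^ j = 1 \<longleftrightarrow> m dvd j"
proof -
  have "zeta m ^ j = 1 \<longleftrightarrow> zeta m ^ (j mod m) = zeta m ^ 0"
    using assms by (simp add: power_mod_root_of_unity)
  also have "\<dots> \<longleftrightarrow> j mod m = 0"
    using assms by (intro inj_on_eq_iff[OF zeta_power_inj]) auto
  finally show ?thesis by auto
qed

lemma zeta_mult_power: "m > 0 \<Longrightarrow> l > 0 \<Longrightarrow> zeta (m * l) ^ l = zeta m"
  unfolding zeta_power_conv_cis zeta_conv_cis[of m] by (simp add: field_simps)

lemma cnj_zeta: "cnj (zeta m) = inverse (zeta m)"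
  by (simp add: zeta_conv_cis cis_cnj)

lemma monic_poly_eq_prod_roots:
  fixes P :: "complex poly"
  assumes "lead_coeff P = 1" "finite A" "card A = degree P" "\<And>a. a \<in> A \<Longrightarrow> poly P a = 0"
  shows "P = (\<Prod>a\<in>A. [:-a, 1:])"
proof (rule poly_eqI_degree_lead_coeff[where n = "degree P" and A = A])
  show "degree (\<Prod>a\<in>A. [:- a, 1:]) \<le> degree P"
    using assms(3) by (subst degree_prod_eq_sum_degree) auto
  have "lead_coeff (\<Prod>a\<in>A. [:- a, 1:]) = 1"
    by (simp add: lead_coeff_prod)
  moreover have "degree (\<Prod>a\<in>A. [:- a, 1:]) = degree P"
    using assms(3) by (subst degree_prod_eq_sum_degree) auto
  ultimately show "coeff P (degree P) = coeff (\<Prod>a\<in>A. [:- a, 1:]) (degree P)"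
    using assms(1) by simp
  fix a assume "a \<in> A"
  thus "poly P a = poly (\<Prod>a\<in>A. [:- a, 1:]) a"
    using assms by (auto simp: poly_prod)
qed (use assms in auto)

lemma sum_root_of_unity_powers_eq_0:
  fixes w :: complex
  assumes "w ^ N = 1" "w \<noteq> 1"
  shows "(\<Sum>i<N. w ^ i) = 0"
  using assms geometric_sum[of w N] by simp

text \<open>
  The ring in question is \<open>\<int>[\<zeta>]\<close>, in which \<open>\<pi>\<close> will turn out to be the prime above \<open>p\<close>; \<open>\<omega>\<close> equals \<open>\<zeta>^q\<close>.
\<close>
locale odd_prime_power =
  fixes p k :: nat
  assumes prime_p: "prime p" and odd_p: "odd p" and k_pos: "k \<ge> 1"
begin

definition q :: nat where "q = p ^ (k - 1)"
definition N :: nat where "N = p ^ k"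
definition totient_N :: nat where "totient_N = (p - 1) * q"
definition \<zeta> :: complex where "\<zeta> = zeta N"
definition \<omega> :: complex where "\<omega> = zeta p"
definition \<pi> :: complex where "\<pi> = 1 - \<zeta>"

lemma p_gt_2: "p > 2"
  using prime_p odd_p prime_gt_1_nat[of p] by (cases "p = 2") auto

lemma q_pos [simp]: "q > 0" using p_gt_2 by (simp add: q_def)

lemma N_eq: "N = p * q"
  unfolding N_def q_def using k_pos by (cases k) simp_all

lemma N_pos [simp]: "N > 0" using p_gt_2 by (simp add: N_def)

lemma odd_N: "odd N" using odd_p by (simp add: N_def)

lemma N_eq_totient_plus: "N = totient_N + q"
  using p_gt_2 by (simp add: N_eq totient_N_def algebra_simps)

lemma totient_N_pos [simp]: "totient_N > 0"
  using p_gt_2 by (simp add: totient_N_def)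

lemma even_totient_N: "even totient_N"
  using odd_p by (simp add: totient_N_def)

lemma zeta_power_N [simp]: "\<zeta> ^ N = 1" by (simp add: \<zeta>_def)

lemma zeta_power_q: "\<zeta> ^ q = \<omega>"
  using p_gt_2 by (simp add: \<zeta>_def \<omega>_def N_eq zeta_mult_power)

lemma omega_power_p [simp]: "\<omega> ^ p = 1"
  using p_gt_2 by (simp add: \<omega>_def)

lemma omega_power_eq_1_iff: "\<omega> ^ j = 1 \<longleftrightarrow> p dvd j"
  using p_gt_2 by (simp add: \<omega>_def zeta_power_eq_1_iff)

lemma omega_neq_1: "\<omega> \<noteq> 1"
  using omega_power_eq_1_iff[of 1] p_gt_2 by auto

lemma sum_omega_powers [simp]: "(\<Sum>i<p. \<omega> ^ i) = 0"
  by (intro sum_root_of_unity_powers_eq_0 omega_neq_1) auto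

lemma omega_in_Zadj [simp, intro]: "\<omega> \<in> Zadj \<zeta>"
  by (auto simp flip: zeta_power_q)

lemma pi_in_Zadj [simp, intro]: "\<pi> \<in> Zadj \<zeta>"
  by (auto simp: \<pi>_def)

lemma pi_nonzero [simp]: "\<pi> \<noteq> 0"
proof -
  have "\<not> N dvd 1" using N_eq p_gt_2 by auto
  thus ?thesis using zeta_power_eq_1_iff[of N 1] by (auto simp: \<pi>_def \<zeta>_def)
qed

lemma zeta_powi_in_Zadj [simp, intro]: "\<zeta> powi m \<in> Zadj \<zeta>"
proof (cases "m \<ge> 0")
  case False
  have "inverse \<zeta> = \<zeta> ^ (N - 1)"
    using power_minus_mult[of N \<zeta>] by (intro inverse_unique) (simp add: mult.commute)
  thus ?thesis using False by (auto simp: power_int_def simp flip: power_inverse)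
qed (auto simp: power_int_def)

lemma omega_powi_in_Zadj [simp, intro]: "\<omega> powi m \<in> Zadj \<omega>"
proof (cases "m \<ge> 0")
  case False
  have "inverse \<omega> = \<omega> ^ (p - 1)"
    using power_minus_mult[of p \<omega>] p_gt_2 by (intro inverse_unique) (simp add: mult.commute)
  thus ?thesis using False by (auto simp: power_int_def simp flip: power_inverse)
qed (auto simp: power_int_def)

lemma Zadj_cnj [intro]: "x \<in> Zadj \<zeta> \<Longrightarrow> cnj x \<in> Zadj \<zeta>"
proof -
  assume "x \<in> Zadj \<zeta>"
  then obtain P where "x = ipoly P \<zeta>" by (auto simp: Zadj_def)
  moreover have "cnj (ipoly P \<zeta>) = ipoly P (cnj \<zeta>)"
    by (induction P) auto
  moreover have "cnj \<zeta> \<in> Zadj \<zeta>"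
    using zeta_powi_in_Zadj[of "-1"] by (simp add: \<zeta>_def cnj_zeta)
  ultimately show ?thesis by (auto intro: Zadj_trans)
qed

definition units_N :: "nat set" where "units_N = {c\<in>{..<N}. \<not> p dvd c}"

lemma card_units_N: "card units_N = totient_N"
proof -
  have "{c\<in>{..<N}. p dvd c} = (\<lambda>i. p * i) ` {..<q}"
    using p_gt_2 by (auto simp: N_eq)
  hence "card {c\<in>{..<N}. p dvd c} = q"
    using p_gt_2 by (simp add: card_image inj_on_def)
  moreover have "{..<N} = units_N \<union> {c\<in>{..<N}. p dvd c}" by (auto simp: units_N_def)
  hence "card {..<N} = card units_N + card {c\<in>{..<N}. p dvd c}"
    by (metis (no_types, lifting) card_Un_disjoint disjoint_iff finite_Un finite_lessThan mem_Collect_eq units_N_def)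
  ultimately show ?thesis using N_eq_totient_plus by simp
qed

text \<open>
  The polynomial \<open>1 + x^q + \<dots> + x^((p-1)q)\<close> is the \<open>N\<close>-th cyclotomic polynomial: its roots
  are the primitive \<open>N\<close>-th roots of unity. Evaluate its factorization at \<open>1\<close>.
\<close>
lemma prod_one_minus_zeta: "(\<Prod>c\<in>units_N. 1 - \<zeta> ^ c) = of_nat p"
proof -
  define P :: "complex poly" where "P = (\<Sum>i<p. Polynomial.monom 1 (q * i))"
  have poly_P: "poly P x = (\<Sum>i<p. (x ^ q) ^ i)" for x
    by (simp add: P_def poly_sum poly_monom power_mult)
  have split: "P = (\<Sum>i<p-1. Polynomial.monom 1 (q * i)) + Polynomial.monom 1 totient_N"
  proof -
    have "{..<p} = insert (p - 1) {..<p - 1}" using p_gt_2 by auto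
    thus ?thesis by (simp add: P_def totient_N_def mult.commute add.commute)
  qed
  have low: "degree (\<Sum>i<p-1. Polynomial.monom 1 (q * i) :: complex poly) < totient_N"
    using p_gt_2 by (intro degree_sum_less) (auto simp: degree_monom_eq totient_N_def)
  have deg: "degree P = totient_N"
    using low unfolding split by (subst degree_add_eq_right) (auto simp: degree_monom_eq)
  have lc: "lead_coeff P = 1"
    unfolding deg using low by (simp add: split coeff_eq_0)
  have inj: "inj_on (\<lambda>c. \<zeta> ^ c) units_N"
    unfolding \<zeta>_def by (rule inj_on_subset[OF zeta_power_inj]) (auto simp: units_N_def)
  have root: "poly P (\<zeta> ^ c) = 0" if "c \<in> units_N" for c
  proof -
    have "(\<zeta> ^ c) ^ q = \<omega> ^ c" by (simp add: mult.commute flip: zeta_power_q power_mult)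
    moreover have "\<omega> ^ c \<noteq> 1" using that by (auto simp: omega_power_eq_1_iff units_N_def)
    moreover have "(\<omega> ^ c) ^ p = 1" by (metis omega_power_p power_commutes power_mult mult.commute power_one)
    ultimately show ?thesis by (simp add: poly_P sum_root_of_unity_powers_eq_0)
  qed
  have "P = (\<Prod>a\<in>(\<lambda>c. \<zeta> ^ c) ` units_N. [:-a, 1:])"
    using lc deg root inj card_units_N
    by (intro monic_poly_eq_prod_roots) (auto simp: card_image units_N_def)
  hence "poly P 1 = (\<Prod>c\<in>units_N. 1 - \<zeta> ^ c)"
    by (simp add: prod.reindex[OF inj] poly_prod)
  thus ?thesis by (simp add: poly_P)
qed

lemma exists_inverse_mod_N:
  assumes "c \<in> units_N"
  obtains c' where "\<zeta> ^ (c * c') = \<zeta>"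
proof -
  have "coprime p c" using assms prime_p
    by (auto simp: units_N_def intro: prime_imp_coprime)
  hence "coprime c N" by (simp add: N_def coprime_commute)
  then obtain c' where "[c * c' = 1] (mod N)" using cong_solve_coprime_nat[of c N] by auto
  hence eq: "\<zeta> ^ ((c * c') mod N) = \<zeta> ^ (1 mod N)" by (simp add: cong_def)
  show ?thesis
    by (rule that) (use eq in \<open>simp only: power_mod_root_of_unity[OF zeta_power_N] power_one_right\<close>)
qed

lemma one_minus_zeta_power: "1 - \<zeta> ^ c = \<pi> * (\<Sum>i<c. \<zeta> ^ i)"
  unfolding \<pi>_def by (rule one_diff_power_eq)

text \<open>
  Each factor \<open>1 - \<zeta>^c\<close> of the product formula is an associate of \<open>\<pi>\<close>, since \<open>\<zeta>\<close> is in turn a power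
  of \<open>\<zeta>^c\<close>. This lemma and the next one say that \<open>p\<close> and the power of \<open>\<pi>\<close> divide each other.
\<close>
lemma p_eq_pi_power_mult:
  obtains u where "u \<in> Zadj \<zeta>" "of_nat p = \<pi> ^ totient_N * u"
proof
  show "of_nat p = \<pi> ^ totient_N * (\<Prod>c\<in>units_N. \<Sum>i<c. \<zeta> ^ i)"
    by (simp add: one_minus_zeta_power prod.distrib card_units_N flip: prod_one_minus_zeta)
qed auto

lemma pi_power_eq_p_mult:
  obtains v where "v \<in> Zadj \<zeta>" "\<pi> ^ totient_N = of_nat p * v"
proof -
  have "\<exists>v. v \<in> Zadj \<zeta> \<and> \<pi> = (1 - \<zeta> ^ c) * v" if c: "c \<in> units_N" for c
  proof -
    obtain c' where "\<zeta> ^ (c * c') = \<zeta>" using exists_inverse_mod_N[OF c] .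
    hence "\<pi> = (1 - \<zeta> ^ c) * (\<Sum>i<c'. (\<zeta> ^ c) ^ i)"
      using one_diff_power_eq[of "\<zeta> ^ c" c'] by (simp add: \<pi>_def power_mult)
    moreover have "(\<Sum>i<c'. (\<zeta> ^ c) ^ i) \<in> Zadj \<zeta>" by auto
    ultimately show ?thesis by (intro exI conjI)
  qed
  hence "\<forall>c\<in>units_N. \<exists>v. v \<in> Zadj \<zeta> \<and> \<pi> = (1 - \<zeta> ^ c) * v" ..
  from bchoice[OF this] obtain v where v: "\<And>c. c \<in> units_N \<Longrightarrow> v c \<in> Zadj \<zeta>"
      "\<And>c. c \<in> units_N \<Longrightarrow> \<pi> = (1 - \<zeta> ^ c) * v c" by blast
  have "\<pi> ^ totient_N = (\<Prod>c\<in>units_N. (1 - \<zeta> ^ c) * v c)"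
    unfolding card_units_N[symmetric] prod_constant[symmetric] by (intro prod.cong refl v(2))
  also have "\<dots> = of_nat p * (\<Prod>c\<in>units_N. v c)"
    by (simp add: prod.distrib prod_one_minus_zeta)
  finally show ?thesis using that v(1) by blast
qed

text \<open>
  Raise the equation to the power at which \<open>\<pi>\<close> becomes a multiple of \<open>p\<close>.
\<close>
lemma prime_dvd_int_of_pi:
  assumes "x \<in> Zadj \<zeta>" "of_int a = \<pi> * x"
  shows "int p dvd a"
proof -
  obtain v where v: "v \<in> Zadj \<zeta>" "\<pi> ^ totient_N = of_nat p * v" using pi_power_eq_p_mult .
  have "of_int (a ^ totient_N) = of_nat p * (v * x ^ totient_N)"
    by (simp add: assms(2) power_mult_distrib v(2))
  hence "int p dvd a ^ totient_N"
    by (rule prime_dvd_int_of_Zadj[OF zeta_power_N N_pos prime_p, rotated]) (use v(1) assms(1) in auto)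
  thus ?thesis using prime_p by (metis prime_dvd_power_int prime_nat_int_transfer)
qed

text \<open>
  The residue ring modulo \<open>\<pi>\<close> consists of classes of integers because \<open>\<zeta>\<close> is \<open>1\<close> modulo \<open>\<pi>\<close>.
\<close>
lemma int_mod_pi:
  assumes "x \<in> Zadj \<zeta>"
  obtains a y where "y \<in> Zadj \<zeta>" "x = of_int a + \<pi> * y"
proof -
  obtain c where c: "x = (\<Sum>j<N. of_int (c j) * \<zeta> ^ j)"
    using Zadj_rep[OF zeta_power_N N_pos assms] .
  have "x = of_int (\<Sum>j<N. c j) + (\<Sum>j<N. of_int (c j) * (\<zeta> ^ j - 1))"
    by (simp add: c algebra_simps sum_subtractf)
  also have "(\<Sum>j<N. of_int (c j) * (\<zeta> ^ j - 1)) = (\<Sum>j<N. \<pi> * (of_int (- c j) * (\<Sum>i<j. \<zeta> ^ i)))"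
  proof (intro sum.cong refl)
    fix j
    show "of_int (c j) * (\<zeta> ^ j - 1) = \<pi> * (of_int (- c j) * (\<Sum>i<j. \<zeta> ^ i))"
    proof -
      have "\<pi> * (of_int (- c j) * (\<Sum>i<j. \<zeta> ^ i)) = of_int (- c j) * (\<pi> * (\<Sum>i<j. \<zeta> ^ i))"
        by (simp only: mult.left_commute)
      also have "\<dots> = of_int (c j) * (\<zeta> ^ j - 1)"
        unfolding one_minus_zeta_power[symmetric] by (simp add: algebra_simps)
      finally show ?thesis ..
    qed
  qed
  finally have "x = of_int (\<Sum>j<N. c j) + \<pi> * (\<Sum>j<N. of_int (- c j) * (\<Sum>i<j. \<zeta> ^ i))"
    by (simp add: sum_distrib_left)
  thus ?thesis by (rule that[rotated]) blast
qed

text \<open>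
  Modulo \<open>\<pi>\<close> both factors are integers, and for integers divisibility by \<open>\<pi>\<close> and by \<open>p\<close> agree.
\<close>
lemma pi_prime:
  assumes x: "x \<in> Zadj \<zeta>" and y: "y \<in> Zadj \<zeta>" and z: "z \<in> Zadj \<zeta>" "x * y = \<pi> * z"
  shows "(\<exists>x'\<in>Zadj \<zeta>. x = \<pi> * x') \<or> (\<exists>y'\<in>Zadj \<zeta>. y = \<pi> * y')"
proof -
  obtain u where u: "u \<in> Zadj \<zeta>" "of_nat p = \<pi> ^ totient_N * u" using p_eq_pi_power_mult .
  obtain a x' where a: "x' \<in> Zadj \<zeta>" "x = of_int a + \<pi> * x'" using int_mod_pi[OF x] .
  obtain b y' where b: "y' \<in> Zadj \<zeta>" "y = of_int b + \<pi> * y'" using int_mod_pi[OF y] .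
  have "of_int (a * b) = \<pi> * (z - x' * y - of_int a * y')"
    using z(2) a(2) b(2) by (simp add: algebra_simps)
  hence "int p dvd a * b"
    by (rule prime_dvd_int_of_pi[rotated]) (use x y z a b in \<open>auto intro!: Zadj_diff Zadj_mult\<close>)
  hence "int p dvd a \<or> int p dvd b"
    using prime_p by (meson prime_dvd_multD prime_nat_int_transfer)
  moreover have *: "\<exists>d\<in>Zadj \<zeta>. of_int c + \<pi> * e = \<pi> * d" if c: "int p dvd c" and e: "e \<in> Zadj \<zeta>" for c e
  proof -
    obtain c' where "c = int p * c'" using c by blast
    moreover have "\<pi> ^ totient_N = \<pi> * \<pi> ^ (totient_N - 1)"
      by (simp flip: power_Suc)
    ultimately have "of_int c + \<pi> * e = \<pi> * (\<pi> ^ (totient_N - 1) * u * of_int c' + e)"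
      using u(2) by (simp add: algebra_simps)
    moreover have "\<pi> ^ (totient_N - 1) * u * of_int c' + e \<in> Zadj \<zeta>" using u(1) e by blast
    ultimately show ?thesis by blast
  qed
  ultimately show ?thesis using a b by blast
qed

end

section \<open>Linear relations between powers of the root of unity\<close>

text \<open>
  The division algorithm, as a rule for splitting sums.
\<close>
lemma sum_blocks:
  fixes h :: "nat \<Rightarrow> 'a::comm_monoid_add"
  shows "(\<Sum>j<m * l. h j) = (\<Sum>d<l. \<Sum>i<m. h (d + l * i))"
proof -
  have "(\<Sum>j<m * l. h j) = (\<Sum>i<m. sum h {i * l..<i * l + l})"
    by (rule sum.nat_group [symmetric])
  also have "\<dots> = (\<Sum>i<m. \<Sum>d<l. h (d + l * i))"
  proof (rule sum.cong[OF refl])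
    fix i
    show "sum h {i * l..<i * l + l} = (\<Sum>d<l. h (d + l * i))"
      using sum.shift_bounds_nat_ivl[of h 0 "i * l" l]
      by (simp add: add.commute mult.commute atLeast0LessThan)
  qed
  also have "\<dots> = (\<Sum>d<l. \<Sum>i<m. h (d + l * i))" by (rule sum.swap)
  finally show ?thesis .
qed

lemma square_sum_eq_1:
  fixes x :: "'a \<Rightarrow> int"
  assumes "finite A" "(\<Sum>i\<in>A. (x i)\<^sup>2) = 1"
  shows "\<exists>i\<in>A. x i \<in> {1, -1} \<and> (\<forall>j\<in>A. j \<noteq> i \<longrightarrow> x j = 0)"
proof -
  obtain i where i: "i \<in> A" "x i \<noteq> 0"
    using assms(2) by (metis (no_types, lifting) sum.neutral zero_neq_one zero_power2)
  have sum: "(x i)\<^sup>2 + (\<Sum>j\<in>A-{i}. (x j)\<^sup>2) = 1"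
    using sum.remove[OF assms(1) i(1), of "\<lambda>j. (x j)\<^sup>2"] assms(2) by simp
  moreover have "(x i)\<^sup>2 \<ge> 1" using i(2) by (simp add: int_one_le_iff_zero_less)
  moreover have "(\<Sum>j\<in>A-{i}. (x j)\<^sup>2) \<ge> 0" by (intro sum_nonneg) auto
  ultimately have "(x i)\<^sup>2 = 1" "(\<Sum>j\<in>A-{i}. (x j)\<^sup>2) = 0" by linarith+
  thus ?thesis using i(1) assms(1)
    by (intro bexI[of _ i]) (auto simp: sum_nonneg_eq_0_iff power2_eq_1_iff)
qed

lemma int_le_square: "\<bar>x\<bar> \<le> x\<^sup>2" for x :: int
  by (cases "x = 0") (use self_le_power[of "\<bar>x\<bar>" 2] in auto)

text \<open>
  If \<open>A\<close> has \<open>m\<close> elements, \<open>D\<close> is \<open>m\<^sup>2\<close> times the variance of \<open>x\<close>. With \<open>s\<close> the sum of \<open>x\<close>, the sum of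
  squares is at least \<open>\<bar>s\<bar>\<close>, so that \<open>D \<ge> \<bar>s\<bar> * (m - \<bar>s\<bar>)\<close>, which is at least \<open>m - 1\<close> when \<open>s \<noteq> 0\<close>.
\<close>
lemma small_sum_variance:
  fixes x :: "'a \<Rightarrow> int" and m :: int
  assumes A: "finite A" and small: "2 * \<bar>\<Sum>i\<in>A. x i\<bar> \<le> m - 1" and m: "m > 2"
  defines "D \<equiv> m * (\<Sum>i\<in>A. (x i)\<^sup>2) - (\<Sum>i\<in>A. x i)\<^sup>2"
  shows "D = 0 \<Longrightarrow> i \<in> A \<Longrightarrow> x i = 0" and "D = 0 \<or> D \<ge> m - 1"
proof -
  define s Q where "s = (\<Sum>i\<in>A. x i)" and "Q = (\<Sum>i\<in>A. (x i)\<^sup>2)"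
  have Q0: "Q \<ge> 0" by (auto simp: Q_def intro: sum_nonneg)
  have "\<bar>s\<bar> \<le> (\<Sum>i\<in>A. \<bar>x i\<bar>)" unfolding s_def by (rule sum_abs)
  also have "\<dots> \<le> Q" unfolding Q_def by (intro sum_mono int_le_square)
  finally have sQ: "\<bar>s\<bar> \<le> Q" .
  have nz: "D \<ge> m - 1" if "s \<noteq> 0"
  proof -
    have "0 \<le> (\<bar>s\<bar> - 1) * (m - 1 - \<bar>s\<bar>)"
      using that small m by (intro mult_nonneg_nonneg) (auto simp: s_def)
    hence "m - 1 \<le> m * \<bar>s\<bar> - s\<^sup>2" by (simp add: algebra_simps power2_eq_square)
    also have "\<dots> \<le> D"
      using sQ m by (simp add: D_def flip: s_def Q_def)
    finally show ?thesis .
  qed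
  have z: "D = m * Q" if "s = 0" using that by (simp add: D_def s_def Q_def)
  show "D = 0 \<or> D \<ge> m - 1"
  proof (cases "s = 0 \<and> Q \<noteq> 0")
    case True
    hence "m * 1 \<le> m * Q" using Q0 m by (intro mult_left_mono) auto
    thus ?thesis using z True by auto
  qed (use nz z in auto)
  assume "D = 0" "i \<in> A"
  moreover from this have "s = 0" using nz m by auto
  ultimately have "Q = 0" using z m by auto
  thus "x i = 0" using A \<open>i \<in> A\<close> by (auto simp: Q_def sum_nonneg_eq_0_iff)
qed

text \<open>
  The equation makes \<open>m\<close> a divisor of \<open>s\<^sup>2 - 1\<close>, which for a sum \<open>s\<close> this small means \<open>s\<^sup>2 = 1\<close>.
\<close>
lemma small_sum_variance_minimal:
  fixes x :: "'a \<Rightarrow> int" and m :: int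
  assumes "prime m" and small: "2 * \<bar>\<Sum>i\<in>A. x i\<bar> \<le> m - 1" and m: "m > 2"
    and "m * (\<Sum>i\<in>A. (x i)\<^sup>2) - (\<Sum>i\<in>A. x i)\<^sup>2 = m - 1"
  shows "(\<Sum>i\<in>A. (x i)\<^sup>2) = 1"
proof -
  define s Q where "s = (\<Sum>i\<in>A. x i)" and "Q = (\<Sum>i\<in>A. (x i)\<^sup>2)"
  have eq: "m * Q - s\<^sup>2 = m - 1" using assms by (simp add: s_def Q_def)
  hence "(s - 1) * (s + 1) = m * (Q - 1)" by (simp add: algebra_simps power2_eq_square)
  hence "m dvd s - 1 \<or> m dvd s + 1"
    using \<open>prime m\<close> by (metis dvd_triv_left prime_dvd_multD)
  hence "s - 1 = 0 \<or> m \<le> \<bar>s - 1\<bar> \<or> s + 1 = 0 \<or> m \<le> \<bar>s + 1\<bar>"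
    using zdvd_imp_le[of m "\<bar>s - 1\<bar>"] zdvd_imp_le[of m "\<bar>s + 1\<bar>"] by auto
  hence "s = 1 \<or> s = -1"
    using small m unfolding s_def[symmetric] by arith
  hence "s\<^sup>2 = 1" by auto
  with eq m show ?thesis by (simp add: Q_def)
qed

context odd_prime_power
begin

text \<open>
  The substitution \<open>x = 1 - y\<close> turns \<open>P\<close> into a polynomial \<open>D\<close> with \<open>D(\<pi>) = 0\<close>. Suppose that \<open>p\<close>
  divides the coefficients of \<open>D\<close> below the \<open>j\<close>-th. Multiplying the relation by \<open>\<pi>^(totient_N - 1 - j)\<close>, all
  its terms except the \<open>j\<close>-th become multiples of \<open>\<pi>^totient_N\<close>: the lower ones because \<open>p\<close> is such a
  multiple, the higher ones by their exponent. Hence \<open>\<pi>\<close> divides the \<open>j\<close>-th coefficient, and so does \<open>p\<close>.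
\<close>
lemma vanishing_ipoly_dvd_p:
  assumes "degree P < totient_N" "ipoly P \<zeta> = 0"
  shows "[:int p:] dvd P"
proof -
  obtain u where u: "u \<in> Zadj \<zeta>" "of_nat p = \<pi> ^ totient_N * u" using p_eq_pi_power_mult .
  define D where "D = pcompose P [:1, -1:]"
  have deg: "degree D < totient_N" using assms(1) by (simp add: D_def degree_pcompose)
  have "(1 :: complex) - \<pi> = \<zeta>" by (simp add: \<pi>_def)
  hence "ipoly D \<pi> = 0" using assms(2) by (simp add: D_def ipoly_pcompose)
  moreover have "ipoly D \<pi> = (\<Sum>i<totient_N. of_int (coeff D i) * \<pi> ^ i)"
    unfolding ipoly_altdef using deg
    by (intro sum.mono_neutral_left) (auto simp: coeff_eq_0)
  ultimately have D0: "(\<Sum>i<totient_N. of_int (coeff D i) * \<pi> ^ i) = 0" by simp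
  have coeff: "int p dvd coeff D j" if "j < totient_N" for j
    using that
  proof (induction j rule: less_induct)
    case (less j)
    have "\<exists>t. t \<in> Zadj \<zeta> \<and> of_int (coeff D i) * \<pi> ^ i * \<pi> ^ (totient_N - 1 - j) = \<pi> ^ totient_N * t"
      if i: "i \<in> {..<totient_N} - {j}" for i
    proof (cases "i < j")
      case True
      then obtain d where d: "coeff D i = int p * d" using less by auto
      have "of_int (coeff D i) * \<pi> ^ i * \<pi> ^ (totient_N - 1 - j) =
          \<pi> ^ totient_N * (u * of_int d * \<pi> ^ i * \<pi> ^ (totient_N - 1 - j))"
        by (simp add: d u(2))
      moreover have "u * of_int d * \<pi> ^ i * \<pi> ^ (totient_N - 1 - j) \<in> Zadj \<zeta>"
        using u(1) by (intro Zadj_mult Zadj_power) auto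
      ultimately show ?thesis by (intro exI conjI)
    next
      case False
      hence "i + (totient_N - 1 - j) = totient_N + (i - j - 1)" using i less.prems by auto
      hence "of_int (coeff D i) * \<pi> ^ i * \<pi> ^ (totient_N - 1 - j) =
          \<pi> ^ totient_N * (of_int (coeff D i) * \<pi> ^ (i - j - 1))"
        by (simp add: mult.assoc mult.left_commute flip: power_add)
      moreover have "of_int (coeff D i) * \<pi> ^ (i - j - 1) \<in> Zadj \<zeta>"
        by (intro Zadj_mult Zadj_power) auto
      ultimately show ?thesis by (intro exI conjI)
    qed
    hence "\<forall>i\<in>{..<totient_N} - {j}. \<exists>t. t \<in> Zadj \<zeta> \<and>
        of_int (coeff D i) * \<pi> ^ i * \<pi> ^ (totient_N - 1 - j) = \<pi> ^ totient_N * t" ..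
    from bchoice[OF this] obtain t where t: "\<And>i. i \<in> {..<totient_N} - {j} \<Longrightarrow> t i \<in> Zadj \<zeta>"
      "\<And>i. i \<in> {..<totient_N} - {j} \<Longrightarrow>
         of_int (coeff D i) * \<pi> ^ i * \<pi> ^ (totient_N - 1 - j) = \<pi> ^ totient_N * t i" by blast
    have "0 = (\<Sum>i<totient_N. of_int (coeff D i) * \<pi> ^ i) * \<pi> ^ (totient_N - 1 - j)"
      by (simp add: D0)
    also have "\<dots> = (\<Sum>i<totient_N. of_int (coeff D i) * \<pi> ^ i * \<pi> ^ (totient_N - 1 - j))"
      by (rule sum_distrib_right)
    also have "\<dots> = of_int (coeff D j) * \<pi> ^ j * \<pi> ^ (totient_N - 1 - j) +
        (\<Sum>i\<in>{..<totient_N} - {j}. of_int (coeff D i) * \<pi> ^ i * \<pi> ^ (totient_N - 1 - j))"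
      using less.prems by (intro sum.remove) auto
    also have "(\<Sum>i\<in>{..<totient_N} - {j}. of_int (coeff D i) * \<pi> ^ i * \<pi> ^ (totient_N - 1 - j)) =
        (\<Sum>i\<in>{..<totient_N} - {j}. \<pi> ^ totient_N * t i)"
      by (intro sum.cong refl t(2))
    also have "\<dots> = \<pi> ^ (totient_N - 1) * \<pi> * (\<Sum>i\<in>{..<totient_N} - {j}. t i)"
      by (simp add: sum_distrib_left flip: power_Suc2)
    also have "of_int (coeff D j) * \<pi> ^ j * \<pi> ^ (totient_N - 1 - j) = \<pi> ^ (totient_N - 1) * of_int (coeff D j)"
      using less.prems by (simp add: mult.commute mult.left_commute flip: power_add)
    finally have "\<pi> ^ (totient_N - 1) * (of_int (coeff D j) + \<pi> * (\<Sum>i\<in>{..<totient_N} - {j}. t i)) = 0"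
      by (simp add: algebra_simps)
    hence "of_int (coeff D j) = \<pi> * (- (\<Sum>i\<in>{..<totient_N} - {j}. t i))"
      by (simp add: add_eq_0_iff)
    moreover have "- (\<Sum>i\<in>{..<totient_N} - {j}. t i) \<in> Zadj \<zeta>"
      by (intro Zadj_uminus Zadj_sum t(1))
    ultimately show ?case by (rule prime_dvd_int_of_pi[rotated])
  qed
  have "[:int p:] dvd D"
    unfolding const_poly_dvd_iff
  proof
    fix j show "int p dvd coeff D j"
      using coeff[of j] deg by (cases "j < totient_N") (auto simp: coeff_eq_0)
  qed
  then obtain E where "D = [:int p:] * E" by (elim dvdE)
  hence "pcompose D [:1, -1:] = [:int p:] * pcompose E [:1, -1:]"
    by (simp add: pcompose_smult)
  moreover have "pcompose D [:1, -1:] = P"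
    unfolding D_def by (subst pcompose_assoc [symmetric]) (simp add: pcompose_pCons)
  ultimately show ?thesis by (metis dvd_triv_left)
qed

text \<open>
  Infinite descent, dividing by \<open>p\<close>. In other words, the cyclotomic polynomial is irreducible.
\<close>
lemma vanishing_ipoly_eq_0:
  assumes "degree P < totient_N" "ipoly P \<zeta> = 0"
  shows "P = 0"
  using assms
proof (induction "nat \<bar>lead_coeff P\<bar>" arbitrary: P rule: less_induct)
  case less
  obtain E where E: "P = smult (int p) E"
    using vanishing_ipoly_dvd_p[OF less.prems] by (auto elim: dvdE)
  show ?case
  proof (rule ccontr)
    assume "P \<noteq> 0"
    hence "E \<noteq> 0" using E by auto
    have "nat \<bar>lead_coeff E\<bar> < nat \<bar>lead_coeff P\<bar>"
      using \<open>E \<noteq> 0\<close> p_gt_2 by (simp add: E abs_mult)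
    moreover have "degree E < totient_N" "ipoly E \<zeta> = 0"
      using less.prems p_gt_2 by (simp_all add: E ipoly_smult)
    ultimately show False using less.hyps \<open>E \<noteq> 0\<close> by blast
  qed
qed

lemma zeta_powers_independent:
  assumes "(\<Sum>j<totient_N. of_int (c j) * \<zeta> ^ j) = 0" "j < totient_N"
  shows "c j = 0"
proof -
  define P where "P = (\<Sum>j<totient_N. Polynomial.monom (c j) j)"
  have "degree P < totient_N" unfolding P_def
    by (intro degree_sum_less) (auto intro: le_less_trans[OF degree_monom_le])
  moreover have "ipoly P \<zeta> = 0" using assms(1) by (simp add: P_def ipoly_sum_monom)
  ultimately have "P = 0" by (rule vanishing_ipoly_eq_0)
  hence "coeff P j = 0" by simp
  thus ?thesis using assms(2) by (simp add: P_def coeff_sum sum.delta)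
qed

lemma sum_N_blocks: "(\<Sum>j<N. h j) = (\<Sum>d<q. \<Sum>i<p. h (d + q * i))"
  unfolding N_eq by (rule sum_blocks)

lemma block_less_N: "d < q \<Longrightarrow> i < p \<Longrightarrow> d + q * i < N"
proof -
  assume "d < q" "i < p"
  hence "d + q * i < q * Suc i" by simp
  also have "\<dots> \<le> q * p" using \<open>i < p\<close> by (intro mult_le_mono2) auto
  finally show ?thesis by (simp add: N_eq mult.commute)
qed

lemma zeta_power_block: "\<zeta> ^ (d + q * i) = \<zeta> ^ d * \<omega> ^ i"
  by (simp add: power_add power_mult zeta_power_q)

lemma sum_periodic_zeta_powers: "(\<Sum>j<N. g (j mod q) * \<zeta> ^ j) = 0"
proof -
  have "(\<Sum>j<N. g (j mod q) * \<zeta> ^ j) = (\<Sum>d<q. g d * \<zeta> ^ d * (\<Sum>i<p. \<omega> ^ i))"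
    unfolding sum_N_blocks sum_distrib_left zeta_power_block by (simp add: mult.assoc)
  thus ?thesis by simp
qed

text \<open>
  All linear relations between powers of \<open>\<zeta>\<close> come from the vanishing of \<open>1 + \<omega> + \<dots> + \<omega>^(p-1)\<close>: subtract
  the relation of this kind that has the same coefficients at the last \<open>q\<close> exponents.
\<close>
lemma zeta_relation_periodic:
  assumes "(\<Sum>j<N. of_int (c j) * \<zeta> ^ j) = 0"
  obtains g where "\<And>j. j < N \<Longrightarrow> c j = g (j mod q)"
proof -
  define g where "g d = c (totient_N + d)" for d
  define e where "e j = c j - g (j mod q)" for j
  have e_high: "e j = 0" if j: "totient_N \<le> j" "j < N" for j
  proof -
    obtain d where d: "j = totient_N + d" using j(1) by (auto simp: le_iff_add)
    hence "j mod q = d" using j(2) by (simp add: N_eq_totient_plus totient_N_def)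
    thus ?thesis using d by (simp add: e_def g_def)
  qed
  have "(\<Sum>j<totient_N. of_int (e j) * \<zeta> ^ j) = (\<Sum>j<N. of_int (e j) * \<zeta> ^ j)"
    using e_high by (intro sum.mono_neutral_left) (auto simp: N_eq_totient_plus not_less)
  also have "\<dots> = 0"
    using assms sum_periodic_zeta_powers[of "\<lambda>d. of_int (g d)"]
    by (simp add: e_def algebra_simps sum_subtractf)
  finally have "e j = 0" if "j < N" for j
    using zeta_powers_independent[of e j] e_high[of j] that by (cases "j < totient_N") auto
  thus ?thesis using that[of g] by (auto simp: e_def)
qed

text \<open>
  Expanding each \<open>t d\<close> in powers of \<open>\<omega>\<close> gives a relation between the \<open>\<zeta>^(d + q*i)\<close>, whose coefficients
  depend on \<open>d\<close> only.
\<close>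
lemma zeta_powers_independent_over_omega:
  assumes t: "\<And>d. d < q \<Longrightarrow> t d \<in> Zadj \<omega>"
    and sum: "(\<Sum>d<q. \<zeta> ^ d * t d) = 0" and d: "d < q"
  shows "t d = 0"
proof -
  have "\<forall>d\<in>{..<q}. \<exists>c. t d = (\<Sum>i<p. of_int (c i) * \<omega> ^ i)"
  proof
    fix d assume "d \<in> {..<q}"
    thus "\<exists>c. t d = (\<Sum>i<p. of_int (c i) * \<omega> ^ i)"
      using Zadj_rep[OF omega_power_p _ t[of d]] p_gt_2 by (metis lessThan_iff not_less_zero gr0I)
  qed
  from bchoice[OF this] obtain c where c: "\<And>d. d < q \<Longrightarrow> t d = (\<Sum>i<p. of_int (c d i) * \<omega> ^ i)"
    by auto
  have "(\<Sum>j<N. of_int (c (j mod q) (j div q)) * \<zeta> ^ j) = (\<Sum>d<q. \<zeta> ^ d * t d)"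
    unfolding sum_N_blocks zeta_power_block
    by (intro sum.cong refl) (simp add: c sum_distrib_left mult_ac)
  with sum obtain g where g: "\<And>j. j < N \<Longrightarrow> c (j mod q) (j div q) = g (j mod q)"
    using zeta_relation_periodic[of "\<lambda>j. c (j mod q) (j div q)"] by auto
  have "c d i = g d" if "i < p" for i
  proof -
    from g[OF block_less_N[OF d that]] show ?thesis using d by simp
  qed
  hence "t d = of_int (g d) * (\<Sum>i<p. \<omega> ^ i)"
    unfolding c[OF d] sum_distrib_left by (intro sum.cong) auto
  thus ?thesis by simp
qed

text \<open>
  The trace of \<open>\<zeta>^m\<close> from the cyclotomic field to \<open>\<rat>\<close>, divided by \<open>q\<close>.
\<close>
definition trace_weight :: "nat \<Rightarrow> int" where
  "trace_weight m = (if N dvd m then int p else 0) - (if q dvd m then 1 else 0)"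

text \<open>
  The trace of a combination of powers of \<open>\<zeta>\<close> depends only on its value, because relations are
  constant on the classes of exponents modulo \<open>q\<close>, and the weights sum to zero along each class.
\<close>
lemma trace_well_defined:
  assumes A: "finite A" and sum: "(\<Sum>s\<in>A. of_int (a s) * \<zeta> ^ m s) = of_int b"
  shows "(\<Sum>s\<in>A. a s * trace_weight (m s)) = b * (int p - 1)"
proof -
  define c where "c j = (\<Sum>s\<in>{s\<in>A. m s mod N = j}. a s)" for j
  have tw_mod: "trace_weight (j mod N) = trace_weight j" for j
    by (simp add: trace_weight_def dvd_mod_iff N_eq)
  have tw_block: "trace_weight (d + q * i) = (if d = 0 then (if i = 0 then int p else 0) - 1 else 0)"
    if "d < q" "i < p" for d i
  proof -
    have "N dvd d + q * i \<longleftrightarrow> d = 0 \<and> i = 0"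
      using block_less_N[OF that] nat_dvd_not_less[of "d + q * i" N] by auto
    moreover have "q dvd d + q * i \<longleftrightarrow> d = 0"
      using that by (auto simp: dvd_add_left_iff dest: dvd_imp_le)
    ultimately show ?thesis by (simp add: trace_weight_def)
  qed
  have "(\<Sum>j<N. of_int (c j) * \<zeta> ^ j) = (\<Sum>j<N. \<Sum>s\<in>{s\<in>A. m s mod N = j}. of_int (a s) * \<zeta> ^ m s)"
    unfolding c_def of_int_sum sum_distrib_right
    by (intro sum.cong refl) (auto simp: power_mod_root_of_unity)
  also have "\<dots> = of_int b"
    using A by (subst sum.group) (auto simp: sum)
  finally have c: "(\<Sum>j<N. of_int (c j) * \<zeta> ^ j) = of_int b" .
  have "(\<Sum>j<N. of_int (c j - (if j = 0 then b else 0)) * \<zeta> ^ j) =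
      (\<Sum>j<N. of_int (c j) * \<zeta> ^ j) - (\<Sum>j<N. if j = 0 then of_int b else 0)"
    unfolding sum_subtractf[symmetric] by (intro sum.cong refl) (auto simp: algebra_simps)
  hence "(\<Sum>j<N. of_int (c j - (if j = 0 then b else 0)) * \<zeta> ^ j) = 0"
    by (simp add: c sum.delta)
  from zeta_relation_periodic[OF this]
  obtain g where g: "\<And>j. j < N \<Longrightarrow> c j - (if j = 0 then b else 0) = g (j mod q)" by blast
  have "(\<Sum>s\<in>A. a s * trace_weight (m s)) = (\<Sum>j<N. \<Sum>s\<in>{s\<in>A. m s mod N = j}. a s * trace_weight (m s))"
    using A by (subst sum.group) auto
  also have "\<dots> = (\<Sum>j<N. c j * trace_weight j)"
    unfolding c_def sum_distrib_right by (intro sum.cong refl) (auto simp: tw_mod)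
  also have "\<dots> = (\<Sum>j<N. (if j = 0 then b * trace_weight 0 else 0) + g (j mod q) * trace_weight j)"
    by (intro sum.cong refl) (auto simp: algebra_simps simp flip: g)
  also have "\<dots> = b * trace_weight 0 + (\<Sum>j<N. g (j mod q) * trace_weight j)"
    by (simp add: sum.distrib sum.delta)
  also have "(\<Sum>j<N. g (j mod q) * trace_weight j) =
      (\<Sum>d<q. \<Sum>i<p. (if d = 0 then g 0 * ((if i = 0 then int p else 0) - 1) else 0))"
    unfolding sum_N_blocks by (intro sum.cong refl) (auto simp: tw_block)
  also have "\<dots> = (\<Sum>d<q. if d = 0 then \<Sum>i<p. g 0 * ((if i = 0 then int p else 0) - 1) else 0)"
    by (intro sum.cong refl) auto
  also have "\<dots> = g 0 * (\<Sum>i<p. (if i = 0 then int p else 0) - 1)"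
    by (simp add: sum.delta sum_distrib_left)
  also have "(\<Sum>i<p. (if i = 0 then int p else 0) - 1) = 0"
    using p_gt_2 by (simp add: sum_subtractf sum.delta)
  finally show ?thesis by (simp add: trace_weight_def)
qed

section \<open>Cyclotomic integers with prescribed absolute value\<close>

text \<open>
  Write \<open>V\<close> with coefficients \<open>c j\<close>, grouped into \<open>q\<close> blocks of \<open>p\<close> coefficients by the residue of \<open>j\<close> modulo
  \<open>q\<close>. Adding a constant to a block does not change \<open>V\<close>, so the block sums can be made at most \<open>(p-1)/2\<close> in
  absolute value. Divided by \<open>q\<close>, the trace of \<open>V * cnj V\<close> is the sum over the blocks of
  \<open>D = p * (sum of squares) - (sum)\<^sup>2\<close>, and the trace of \<open>1\<close> is \<open>p - 1\<close>; so this sum equals \<open>p - 1\<close>. As a nonzero \<open>D\<close>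
  is at least \<open>p - 1\<close> when the block sum is this small, a single block contributes, and there a single coefficient, equal to \<open>1\<close> or \<open>-1\<close>, is nonzero.
\<close>
lemma unit_norm_is_root_of_unity:
  assumes V: "V \<in> Zadj \<zeta>" and norm: "V * cnj V = 1"
  obtains s j where "s \<in> {1, -1}" "V = s * \<zeta> ^ j"
proof -
  obtain c0 :: "nat \<Rightarrow> int" where c0: "V = (\<Sum>j<N. of_int (c0 j) * \<zeta> ^ j)"
    using Zadj_rep[OF zeta_power_N N_pos V] .
  define h where "h = (int p - 1) div 2"
  have h: "int p = 2 * h + 1" using odd_p by (auto simp: h_def elim!: oddE)
  define t where "t d = ((\<Sum>i<p. c0 (d + q * i)) + h) div int p" for d
  \<comment> \<open>subtracting \<open>t d\<close> from each coefficient of a block lowers the block sum by \<open>p * t d\<close>\<close>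
  define c where "c j = c0 j - t (j mod q)" for j
  define S where "S d = (\<Sum>i<p. c (d + q * i))" for d
  define D where "D d = int p * (\<Sum>i<p. (c (d + q * i))\<^sup>2) - (S d)\<^sup>2" for d
  have V_eq: "V = (\<Sum>j<N. of_int (c j) * \<zeta> ^ j)"
    using sum_periodic_zeta_powers[of "\<lambda>d. of_int (t d)"]
    by (simp add: c0 c_def algebra_simps sum_subtractf)
  have small: "2 * \<bar>S d\<bar> \<le> int p - 1" if "d < q" for d
  proof -
    define s0 where "s0 = (\<Sum>i<p. c0 (d + q * i))"
    have "S d = s0 - int p * ((s0 + h) div int p)"
      using that by (simp add: S_def c_def sum_subtractf t_def s0_def)
    also have "\<dots> = (s0 + h) mod int p - h"
      by (simp add: algebra_simps flip: minus_mult_div_eq_mod)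
    finally have "S d = (s0 + h) mod int p - h" .
    moreover have "0 \<le> (s0 + h) mod int p" "(s0 + h) mod int p < int p"
      using p_gt_2 by auto
    ultimately show ?thesis using h by linarith
  qed
  have cnj_pow: "cnj (\<zeta> ^ l) = \<zeta> ^ (N - l)" if "l < N" for l
  proof -
    have "\<zeta> ^ l * \<zeta> ^ (N - l) = 1" using that by (simp flip: power_add)
    hence "\<zeta> ^ (N - l) = inverse (\<zeta> ^ l)" by (rule inverse_unique [symmetric])
    thus ?thesis by (simp add: \<zeta>_def cnj_zeta power_inverse)
  qed
  have "(\<Sum>x\<in>{..<N}\<times>{..<N}. of_int (c (fst x) * c (snd x)) * \<zeta> ^ (fst x + (N - snd x))) =
      (\<Sum>j<N. \<Sum>l<N. (of_int (c j) * \<zeta> ^ j) * (of_int (c l) * \<zeta> ^ (N - l)))"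
    unfolding sum.cartesian_product by (intro sum.cong) (auto simp: power_add mult_ac)
  also have "\<dots> = V * (\<Sum>l<N. of_int (c l) * \<zeta> ^ (N - l))"
    unfolding V_eq sum_product ..
  also have "(\<Sum>l<N. of_int (c l) * \<zeta> ^ (N - l)) = cnj V"
    by (simp add: V_eq cnj_pow del: complex_cnj_power)
  finally have "(\<Sum>x\<in>{..<N}\<times>{..<N}. of_int (c (fst x) * c (snd x)) * \<zeta> ^ (fst x + (N - snd x))) = of_int 1"
    using norm by simp
  hence "int p - 1 = (\<Sum>x\<in>{..<N}\<times>{..<N}. c (fst x) * c (snd x) * trace_weight (fst x + (N - snd x)))"
    by (subst trace_well_defined) auto
  also have "\<dots> = (\<Sum>j<N. \<Sum>l<N. c j * c l * trace_weight (j + (N - l)))"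
    unfolding sum.cartesian_product by (intro sum.cong) auto
  also have "\<dots> = (\<Sum>j<N. \<Sum>l<N. (if l = j then int p * (c j)\<^sup>2 else 0)
                     - (if j mod q = l mod q then c j * c l else 0))"
  proof (intro sum.cong refl)
    fix j l assume jl: "j \<in> {..<N}" "l \<in> {..<N}"
    have dvd_iff: "m dvd j + (N - l) \<longleftrightarrow> j mod m = l mod m" if "m dvd N" for m
    proof -
      have "m dvd j + (N - l) \<longleftrightarrow> int m dvd int j - int l + int N"
        using jl by (simp add: of_nat_diff algebra_simps flip: int_dvd_int_iff)
      also have "\<dots> \<longleftrightarrow> int m dvd int j - int l"
        using that by (intro dvd_add_left_iff) auto
      also have "\<dots> \<longleftrightarrow> j mod m = l mod m"
        by (metis mod_eq_dvd_iff of_nat_eq_iff zmod_int)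
      finally show ?thesis .
    qed
    show "c j * c l * trace_weight (j + (N - l)) =
      (if l = j then int p * (c j)\<^sup>2 else 0) - (if j mod q = l mod q then c j * c l else 0)"
      using jl dvd_iff[of N] dvd_iff[of q]
      by (auto simp: trace_weight_def N_eq power2_eq_square algebra_simps)
  qed
  also have "\<dots> = (\<Sum>j<N. int p * (c j)\<^sup>2) - (\<Sum>j<N. \<Sum>l<N. if j mod q = l mod q then c j * c l else 0)"
    by (simp add: sum_subtractf sum.delta)
  also have "(\<Sum>j<N. \<Sum>l<N. if j mod q = l mod q then c j * c l else 0) = (\<Sum>d<q. (S d)\<^sup>2)"
  proof -
    have "(\<Sum>j<N. \<Sum>l<N. if j mod q = l mod q then c j * c l else 0) =
        (\<Sum>d<q. \<Sum>i<p. \<Sum>d'<q. if d' = d then \<Sum>i'<p. c (d + q * i) * c (d + q * i') else 0)"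
      unfolding sum_N_blocks by (intro sum.cong refl) auto
    also have "\<dots> = (\<Sum>d<q. (S d)\<^sup>2)"
      by (intro sum.cong refl) (simp add: sum.delta S_def power2_eq_square sum_product)
    finally show ?thesis .
  qed
  also have "(\<Sum>j<N. int p * (c j)\<^sup>2) = (\<Sum>d<q. int p * (\<Sum>i<p. (c (d + q * i))\<^sup>2))"
    unfolding sum_N_blocks sum_distrib_left ..
  finally have total: "(\<Sum>d<q. D d) = int p - 1" by (simp add: D_def sum_subtractf)
  note variance = small_sum_variance[where A = "{..<p}" and m = "int p", OF _ small[unfolded S_def],
      folded S_def, folded D_def]
  have D_zero: "c (d + q * i) = 0" if "d < q" "D d = 0" "i < p" for d i
    using variance(1)[OF _ that(1) _ that(2), of i] that(3) p_gt_2 by auto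
  have D_cases: "D d = 0 \<or> D d \<ge> int p - 1" if "d < q" for d
    using variance(2)[OF _ that] p_gt_2 by auto
  have "\<exists>d<q. D d \<noteq> 0"
  proof (rule ccontr)
    assume "\<not> (\<exists>d<q. D d \<noteq> 0)"
    hence "(\<Sum>d<q. D d) = 0" by (intro sum.neutral) auto
    with total p_gt_2 show False by simp
  qed
  then obtain d where d: "d < q" "D d \<noteq> 0" by blast
  have split: "D d + (\<Sum>d'\<in>{..<q} - {d}. D d') = int p - 1"
    using total sum.remove[of "{..<q}" d D] d by simp
  have nonneg: "D d' \<ge> 0" if "d' < q" for d' using D_cases[OF that] p_gt_2 by auto
  have "D d \<ge> int p - 1" using D_cases d by blast
  moreover have "(\<Sum>d'\<in>{..<q} - {d}. D d') \<ge> 0" using nonneg by (intro sum_nonneg) auto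
  ultimately have Dd: "D d = int p - 1" and rest: "(\<Sum>d'\<in>{..<q} - {d}. D d') = 0"
    using split by linarith+
  have D_rest: "D d' = 0" if "d' < q" "d' \<noteq> d" for d'
    using rest that nonneg by (subst (asm) sum_nonneg_eq_0_iff) auto
  have "(\<Sum>i<p. (c (d + q * i))\<^sup>2) = 1"
    using small_sum_variance_minimal[where A = "{..<p}" and m = "int p" and x = "\<lambda>i. c (d + q * i)"]
      prime_p p_gt_2 small[OF d(1)] Dd by (simp add: D_def S_def)
  from square_sum_eq_1[OF finite_lessThan this]
  obtain i where i: "i < p" "c (d + q * i) \<in> {1, -1}"
      "\<And>i'. i' < p \<Longrightarrow> i' \<noteq> i \<Longrightarrow> c (d + q * i') = 0" by auto
  have "V = (\<Sum>d'<q. \<Sum>i'<p. if d' = d then if i' = i then of_int (c (d + q * i)) * \<zeta> ^ (d + q * i) else 0 else 0)"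
    unfolding V_eq sum_N_blocks using D_zero[OF _ D_rest] i(3) by (intro sum.cong refl) auto
  also have "\<dots> = (\<Sum>d'<q. if d' = d then of_int (c (d + q * i)) * \<zeta> ^ (d + q * i) else 0)"
    using i(1) by (intro sum.cong refl) (auto simp: sum.delta)
  also have "\<dots> = of_int (c (d + q * i)) * \<zeta> ^ (d + q * i)"
    using d(1) by (simp add: sum.delta)
  finally have "V = of_int (c (d + q * i)) * \<zeta> ^ (d + q * i)" .
  moreover have "of_int (c (d + q * i)) \<in> {1, -1 :: complex}" using i(2) by auto
  ultimately show ?thesis by (rule that[rotated])
qed

text \<open>
  Conjugation maps \<open>\<pi>\<close> to a unit times \<open>\<pi>\<close>, so \<open>\<pi>\<close> divides \<open>S\<close> and \<open>cnj S\<close> equally often, which is half as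
  often as it divides \<open>p^n\<close>.
\<close>
lemma pi_power_dvd:
  assumes S: "S \<in> Zadj \<zeta>" "S * cnj S = of_nat p ^ n" and m: "2 * m \<le> totient_N * n"
  shows "\<exists>W\<in>Zadj \<zeta>. S = \<pi> ^ m * W"
  using m
proof (induction m)
  case 0
  thus ?case using S by auto
next
  case (Suc m)
  obtain u where u: "u \<in> Zadj \<zeta>" "of_nat p = \<pi> ^ totient_N * u" using p_eq_pi_power_mult .
  obtain W where W: "W \<in> Zadj \<zeta>" "S = \<pi> ^ m * W" using Suc by auto
  have zz: "\<zeta> * cnj \<zeta> = 1" by (simp add: \<zeta>_def cnj_zeta)
  have pi_cnj: "\<pi> = - \<zeta> * cnj \<pi>" using zz by (simp add: \<pi>_def algebra_simps)
  \<comment> \<open>\<open>r + 1\<close> is the power of \<open>\<pi>\<close> that remains in \<open>W * cnj W\<close>\<close>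
  define r where "r = totient_N * n - 2 * m - 1"
  have r: "totient_N * n = m + m + Suc r" using Suc.prems by (simp add: r_def)
  have pi_pow: "\<pi> ^ m = (- \<zeta>) ^ m * cnj \<pi> ^ m"
    using arg_cong[OF pi_cnj, of "\<lambda>x. x ^ m"] by (simp only: power_mult_distrib)
  have "\<pi> ^ (m + m) * (W * cnj W) = (\<pi> ^ m * W) * (\<pi> ^ m * cnj W)"
    by (simp add: power_add mult_ac)
  also have "\<dots> = (\<pi> ^ m * W) * (((- \<zeta>) ^ m * cnj \<pi> ^ m) * cnj W)"
    by (simp only: pi_pow[symmetric])
  also have "\<dots> = (- \<zeta>) ^ m * (S * cnj S)" by (simp add: W(2) mult_ac)
  also have "\<dots> = (- \<zeta>) ^ m * (\<pi> ^ (totient_N * n) * u ^ n)"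
    by (simp add: S(2) u(2) power_mult_distrib power_mult)
  also have "\<dots> = \<pi> ^ (m + m) * (\<pi> * (\<pi> ^ r * (- \<zeta>) ^ m * u ^ n))"
    unfolding r power_add power_Suc by (simp only: mult_ac)
  finally have "W * cnj W = \<pi> * (\<pi> ^ r * (- \<zeta>) ^ m * u ^ n)" by simp
  moreover have "\<pi> ^ r * (- \<zeta>) ^ m * u ^ n \<in> Zadj \<zeta>"
    using u(1) by (intro Zadj_mult Zadj_power Zadj_uminus) auto
  ultimately have "(\<exists>x'\<in>Zadj \<zeta>. W = \<pi> * x') \<or> (\<exists>y'\<in>Zadj \<zeta>. cnj W = \<pi> * y')"
    using W(1) by (intro pi_prime Zadj_cnj)
  hence "\<exists>x\<in>Zadj \<zeta>. W = \<pi> * x"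
  proof
    assume "\<exists>y'\<in>Zadj \<zeta>. cnj W = \<pi> * y'"
    then obtain y where y: "y \<in> Zadj \<zeta>" "cnj W = \<pi> * y" by blast
    have "W = cnj (cnj W)" by simp
    also have "\<dots> = cnj \<pi> * cnj y" by (simp only: y(2) complex_cnj_mult)
    also have "cnj \<pi> = \<pi> * (- cnj \<zeta>)" using zz by (simp add: \<pi>_def algebra_simps)
    finally have "W = \<pi> * (- cnj \<zeta> * cnj y)" by (simp only: mult.assoc)
    moreover have "- cnj \<zeta> * cnj y \<in> Zadj \<zeta>"
      using y(1) by (intro Zadj_mult Zadj_uminus Zadj_cnj) auto
    ultimately show ?thesis by blast
  qed
  then obtain x where "x \<in> Zadj \<zeta>" "W = \<pi> * x" by blast
  thus ?case using W(2) by (auto simp: mult_ac)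
qed

text \<open>
  Both \<open>S\<close> and \<open>cnj E\<close> are divisible by \<open>\<pi>^(totient_N * n / 2)\<close>, so \<open>p^n\<close> divides their product;
  the quotient has absolute value \<open>1\<close>.
\<close>
lemma equal_norm_associates:
  assumes S: "S \<in> Zadj \<zeta>" "S * cnj S = of_nat p ^ n" and E: "E \<in> Zadj \<zeta>" "E * cnj E = of_nat p ^ n"
  obtains s j where "s \<in> {1, -1}" "S = s * \<zeta> ^ j * E"
proof -
  have m: "2 * ((totient_N div 2) * n) = totient_N * n" using even_totient_N by auto
  obtain W where W: "W \<in> Zadj \<zeta>" "S = \<pi> ^ ((totient_N div 2) * n) * W"
    using pi_power_dvd[OF S, of "(totient_N div 2) * n"] m by auto
  obtain X where X: "X \<in> Zadj \<zeta>" "cnj E = \<pi> ^ ((totient_N div 2) * n) * X"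
    using pi_power_dvd[of "cnj E" n "(totient_N div 2) * n"] m E by (auto simp: mult.commute)
  obtain v where v: "v \<in> Zadj \<zeta>" "\<pi> ^ totient_N = of_nat p * v" using pi_power_eq_p_mult .
  define V where "V = v ^ n * (W * X)"
  have "S * cnj E = \<pi> ^ (2 * ((totient_N div 2) * n)) * (W * X)"
    unfolding W(2) X(2) mult_2 power_add by (simp only: mult_ac)
  also have "\<dots> = of_nat p ^ n * V"
    unfolding m power_mult v(2) V_def by (simp add: power_mult_distrib mult_ac)
  finally have V: "S * cnj E = of_nat p ^ n * V" .
  have pn: "(of_nat p ^ n :: complex) \<noteq> 0" using p_gt_2 by simp
  have "(of_nat p ^ n * of_nat p ^ n) * (V * cnj V) = (S * cnj E) * cnj (S * cnj E)"
    unfolding V by (simp add: mult_ac)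
  also have "\<dots> = (S * cnj S) * (E * cnj E)" by (simp add: mult_ac)
  also have "\<dots> = (of_nat p ^ n * of_nat p ^ n) * 1" by (simp add: S(2) E(2))
  finally have "V * cnj V = 1" using pn p_gt_2 by auto
  moreover have "V \<in> Zadj \<zeta>" unfolding V_def using v W X by (intro Zadj_mult Zadj_power)
  ultimately obtain s j where sj: "s \<in> {1, -1}" "V = s * \<zeta> ^ j"
    using unit_norm_is_root_of_unity by blast
  have "of_nat p ^ n * S = (S * cnj E) * E" unfolding E(2)[symmetric] by (simp only: mult_ac)
  also have "\<dots> = of_nat p ^ n * (s * \<zeta> ^ j * E)" unfolding V sj(2) by (simp only: mult_ac)
  finally have "S = s * \<zeta> ^ j * E" using pn p_gt_2 by auto
  with sj(1) show ?thesis by (rule that)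
qed

text \<open>
  The factor that distinguishes the two cases in the definition of the dual.
\<close>
definition epsilon :: "nat \<Rightarrow> complex" where
  "epsilon n = (if odd n \<and> [p = 3] (mod 4) then \<i> else 1)"

text \<open>
  Pair \<open>j\<close> with \<open>p - j\<close> in \<open>p = (1 - \<omega>) * \<dots> * (1 - \<omega>^(p-1))\<close>. As \<open>1 - \<omega>^(p-j) = -\<omega>^(p-j) * (1 - \<omega>^j)\<close>, the
  product is a square up to a sign and a power of \<open>\<omega>\<close>, and each power of \<open>\<omega>\<close> is a square since \<open>p\<close> is odd.
\<close>
lemma exists_sqrt_p_star:
  obtains \<eta> where "\<eta> \<in> Zadj \<omega>" "\<eta>\<^sup>2 = (- 1) ^ ((p - 1) div 2) * of_nat p"
proof -
  define h where "h = (p - 1) div 2"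
  have p_eq: "p = 2 * h + 1" using odd_p by (auto simp: h_def elim!: oddE)
  define \<theta> where "\<theta> = (\<Prod>j\<in>{1..h}. 1 - \<omega> ^ j)"
  interpret P: odd_prime_power p 1 by unfold_locales (use prime_p odd_p in auto)
  have "P.\<zeta> = \<omega>" unfolding P.\<zeta>_def \<omega>_def P.N_def by simp
  moreover have "P.units_N = {1..2*h}"
  proof (rule Set.set_eqI)
    fix c
    have "c < p \<longleftrightarrow> c \<le> 2 * h" using p_eq by linarith
    thus "c \<in> P.units_N \<longleftrightarrow> c \<in> {1..2*h}"
      unfolding P.units_N_def P.N_def
      using nat_dvd_not_less[of c p] by (cases "c = 0") auto
  qed
  ultimately have "of_nat p = (\<Prod>j\<in>{1..2*h}. 1 - \<omega> ^ j)" using P.prod_one_minus_zeta by simp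
  also have "{1..2*h} = {1..h} \<union> {h+1..2*h}" by auto
  also have "(\<Prod>j\<in>\<dots>. 1 - \<omega> ^ j) = \<theta> * (\<Prod>j\<in>{h+1..2*h}. 1 - \<omega> ^ j)"
    unfolding \<theta>_def by (intro prod.union_disjoint) auto
  also have "(\<Prod>j\<in>{h+1..2*h}. 1 - \<omega> ^ j) = (\<Prod>j\<in>{1..h}. 1 - \<omega> ^ (p - j))"
    by (intro prod.reindex_bij_witness[of _ "\<lambda>j. p - j" "\<lambda>j. p - j"]) (auto simp: p_eq)
  also have "\<dots> = (\<Prod>j\<in>{1..h}. (- 1) * (\<omega> ^ (p - j) * (1 - \<omega> ^ j)))"
  proof (intro prod.cong refl)
    fix j assume "j \<in> {1..h}"
    hence "p - j + j = p" using p_eq by auto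
    hence "\<omega> ^ (p - j) * \<omega> ^ j = 1" using omega_power_p by (metis power_add)
    thus "1 - \<omega> ^ (p - j) = (- 1) * (\<omega> ^ (p - j) * (1 - \<omega> ^ j))" by (simp add: algebra_simps)
  qed
  also have "\<dots> = (- 1) ^ h * \<omega> ^ (\<Sum>j\<in>{1..h}. p - j) * \<theta>"
    unfolding prod.distrib \<theta>_def power_sum by simp
  finally have p1: "of_nat p = (- 1) ^ h * \<omega> ^ (\<Sum>j\<in>{1..h}. p - j) * \<theta>\<^sup>2"
    by (simp add: power2_eq_square mult_ac)
  define T where "T = (\<Sum>j\<in>{1..h}. p - j)"
  \<comment> \<open>\<open>h + 1\<close> is the inverse of \<open>2\<close> modulo \<open>p\<close>\<close>
  have half: "(\<omega> ^ (T * (h + 1)))\<^sup>2 = \<omega> ^ T"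
  proof -
    have "T * (h + 1) * 2 = p * T + T" by (simp add: p_eq algebra_simps)
    hence "(\<omega> ^ (T * (h + 1)))\<^sup>2 = (\<omega> ^ p) ^ T * \<omega> ^ T"
      by (simp only: flip: power_mult power_add)
    thus ?thesis by simp
  qed
  show ?thesis
  proof (rule that[of "\<omega> ^ (T * (h + 1)) * \<theta>"])
    show "\<omega> ^ (T * (h + 1)) * \<theta> \<in> Zadj \<omega>" unfolding \<theta>_def
      by (intro Zadj_mult Zadj_prod Zadj_power Zadj_diff Zadj_1 Zadj_gen)
    show "(\<omega> ^ (T * (h + 1)) * \<theta>)\<^sup>2 = (- 1) ^ ((p - 1) div 2) * of_nat p"
      unfolding power_mult_distrib half p1 T_def[symmetric] h_def[symmetric]
      by (simp flip: power_add mult_2)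
  qed
qed

text \<open>
  Up to sign, \<open>epsilon n * p^(n/2)\<close> lies in \<open>\<int>[\<omega>]\<close>. This supplies an element of absolute value
  \<open>p^(n/2)\<close> to compare Walsh sums with, and later a multiplier that is defined over \<open>\<int>[\<omega>]\<close>.
\<close>
lemma sqrt_p_star_power:
  obtains \<eta> where "\<eta> \<in> Zadj \<omega>"
    "\<And>n. \<exists>s\<in>{1, -1}. \<eta> ^ n = s * epsilon n * of_real (sqrt p) ^ n"
proof -
  obtain \<eta> where \<eta>: "\<eta> \<in> Zadj \<omega>" "\<eta>\<^sup>2 = (- 1) ^ ((p - 1) div 2) * of_nat p"
    using exists_sqrt_p_star .
  have sqrt_sq: "(complex_of_real (sqrt p))\<^sup>2 = of_nat p" by (simp flip: of_real_power)
  have sign_power: "s ^ n \<in> {1, -1}" if "s \<in> {1, -1}" for s :: complex and n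
    using that by (cases "even n") auto
  have "p mod 4 = 1 \<or> p mod 4 = 3" using odd_p by presburger
  hence "\<exists>s\<in>{1, -1}. \<eta> ^ n = s * epsilon n * of_real (sqrt p) ^ n" for n
  proof
    assume p1: "p mod 4 = 1"
    hence "even ((p - 1) div 2)" by presburger
    hence "\<eta>\<^sup>2 = (of_real (sqrt p))\<^sup>2" by (simp add: \<eta>(2) sqrt_sq)
    hence "\<eta> = 1 * of_real (sqrt p) \<or> \<eta> = (- 1) * of_real (sqrt p)"
      by (simp add: power2_eq_iff)
    then obtain s :: complex where s: "s \<in> {1, -1}" "\<eta> = s * of_real (sqrt p)" by blast
    thus ?thesis using sign_power[OF s(1), of n] p1
      by (intro bexI[of _ "s ^ n"]) (auto simp: power_mult_distrib epsilon_def cong_def)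
  next
    assume p3: "p mod 4 = 3"
    hence "odd ((p - 1) div 2)" by presburger
    hence "\<eta>\<^sup>2 = (\<i> * of_real (sqrt p))\<^sup>2" by (simp add: \<eta>(2) sqrt_sq power_mult_distrib)
    hence "\<eta> = 1 * (\<i> * of_real (sqrt p)) \<or> \<eta> = (- 1) * (\<i> * of_real (sqrt p))"
      by (simp add: power2_eq_iff)
    then obtain s :: complex where s: "s \<in> {1, -1}" "\<eta> = s * (\<i> * of_real (sqrt p))" by blast
    have "\<i> ^ n = (- 1) ^ (n div 2) * epsilon n"
      using p3 by (cases "even n") (auto simp: epsilon_def cong_def power_mult elim!: evenE oddE)
    hence "\<eta> ^ n = (s ^ n * (- 1) ^ (n div 2)) * epsilon n * of_real (sqrt p) ^ n"
      unfolding s(2) power_mult_distrib by (simp only: mult_ac)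
    moreover have "s ^ n * (- 1) ^ (n div 2) \<in> {1, -1}"
      using sign_power[OF s(1), of n] by (auto simp: minus_one_power_iff)
    ultimately show ?thesis by blast
  qed
  thus ?thesis using that \<eta>(1) by blast
qed

section \<open>Duals of gbent functions and of their components\<close>

end

lemma finite_Zvec [simp]: "finite (Zvec p n)"
  by (auto simp: Zvec_def residue_ring_def intro!: finite_PiE)

lemma GB_iff: "F \<in> GB p n r \<longleftrightarrow> F \<in> extensional (Zvec p n) \<and> (\<forall>x\<in>Zvec p n. 0 \<le> F x \<and> F x < int p ^ r)"
  by (auto simp: GB_def residue_ring_def PiE_iff)

lemma powr_neg_half_eq:
  assumes "p > 0"
  shows "real p powr (- real n / 2) = inverse (sqrt p ^ n)"
proof -
  have "sqrt p ^ n = real p powr (real n / 2)"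
    using assms by (simp add: powr_powr flip: powr_half_sqrt powr_realpow)
  thus ?thesis by (simp add: powr_minus)
qed

context odd_prime_power
begin

definition walsh_sum :: "nat \<Rightarrow> ((nat \<Rightarrow> int) \<Rightarrow> int) \<Rightarrow> (nat \<Rightarrow> int) \<Rightarrow> complex" where
  "walsh_sum n F u = (\<Sum>x\<in>Zvec p n. \<omega> powi (- (\<Sum>i<n. u i * x i)) * \<zeta> powi F x)"

lemma walsh_hadamard_eq: "walsh_hadamard p n k F u = walsh_sum n F u / of_real (sqrt p) ^ n"
proof -
  have "p > 0" using p_gt_2 by simp
  show ?thesis
    unfolding walsh_hadamard_def powr_neg_half_eq[OF \<open>p > 0\<close>] walsh_sum_def \<omega>_def \<zeta>_def N_def
    by (simp add: divide_inverse)
qed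

lemma walsh_sum_in_Zadj: "walsh_sum n F u \<in> Zadj \<zeta>"
  unfolding walsh_sum_def
  by (intro Zadj_sum Zadj_mult zeta_powi_in_Zadj Zadj_trans[OF omega_powi_in_Zadj omega_in_Zadj])

lemma sqrt_power_nonzero: "complex_of_real (sqrt p) ^ n \<noteq> 0"
  using p_gt_2 by simp

lemma sqrt_power_norm: "(complex_of_real (sqrt p) ^ n) * cnj (complex_of_real (sqrt p) ^ n) = of_nat p ^ n"
  by (simp flip: power_mult_distrib of_real_mult)

lemma epsilon_nonzero: "epsilon n \<noteq> 0"
  by (simp add: epsilon_def)

lemma epsilon_norm: "epsilon n * cnj (epsilon n) = 1"
  by (simp add: epsilon_def)

lemma is_dual_iff:
  "is_dual p n k F G \<longleftrightarrow> G \<in> GB p n k \<and>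
     (\<forall>u\<in>Zvec p n. \<exists>s\<in>{1, -1}. walsh_sum n F u = s * epsilon n * of_real (sqrt p) ^ n * \<zeta> powi G u)"
  using sqrt_power_nonzero[of n]
  by (simp add: is_dual_def walsh_hadamard_eq epsilon_def \<zeta>_def N_def divide_eq_eq mult_ac)

lemma gbent_walsh_sum:
  assumes "gbent p n k F" "u \<in> Zvec p n"
  obtains s j where "s \<in> {1, -1}" "walsh_sum n F u = s * epsilon n * of_real (sqrt p) ^ n * \<zeta> ^ j"
proof -
  obtain \<eta> where \<eta>: "\<eta> \<in> Zadj \<omega>" "\<And>n. \<exists>s\<in>{1, -1}. \<eta> ^ n = s * epsilon n * of_real (sqrt p) ^ n"
    using sqrt_p_star_power by blast
  obtain s where s: "s \<in> {1, -1}" "\<eta> ^ n = s * epsilon n * of_real (sqrt p) ^ n" using \<eta>(2) by blast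
  have s1: "s * cnj s = 1" using s(1) by auto
  have "\<eta> ^ n * cnj (\<eta> ^ n) = (s * cnj s) * (epsilon n * cnj (epsilon n)) *
      ((complex_of_real (sqrt p) ^ n) * cnj (complex_of_real (sqrt p) ^ n))"
    unfolding s(2) complex_cnj_mult by (simp only: mult_ac)
  hence \<eta>_norm: "\<eta> ^ n * cnj (\<eta> ^ n) = of_nat p ^ n"
    unfolding s1 epsilon_norm sqrt_power_norm by simp
  have "cmod (walsh_sum n F u / of_real (sqrt p) ^ n) = 1"
    using assms by (simp add: gbent_def flip: walsh_hadamard_eq)
  hence "cmod (walsh_sum n F u) = sqrt p ^ n"
    using p_gt_2 by (simp add: norm_divide norm_power)
  moreover have "(sqrt p ^ n)\<^sup>2 = ((sqrt p)\<^sup>2) ^ n" by (metis power_mult mult.commute)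
  ultimately have "(cmod (walsh_sum n F u))\<^sup>2 = real p ^ n" by simp
  hence "walsh_sum n F u * cnj (walsh_sum n F u) = of_nat p ^ n"
    by (simp flip: complex_norm_square)
  moreover have "\<eta> ^ n \<in> Zadj \<zeta>" using Zadj_trans[OF \<eta>(1) omega_in_Zadj] by (rule Zadj_power)
  ultimately obtain s' j where s': "s' \<in> {1, -1}" "walsh_sum n F u = s' * \<zeta> ^ j * \<eta> ^ n"
    using equal_norm_associates[OF walsh_sum_in_Zadj _ _ \<eta>_norm] by metis
  show ?thesis
    by (rule that[of "s' * s" j]) (use s s' in auto)
qed

lemma gbent_has_dual:
  assumes "gbent p n k F"
  obtains G where "is_dual p n k F G"
proof -
  have "\<forall>u\<in>Zvec p n. \<exists>j. \<exists>s\<in>{1, -1}. walsh_sum n F u = s * epsilon n * of_real (sqrt p) ^ n * \<zeta> ^ j"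
  proof
    fix u assume "u \<in> Zvec p n"
    from gbent_walsh_sum[OF assms this]
    show "\<exists>j. \<exists>s\<in>{1, -1}. walsh_sum n F u = s * epsilon n * of_real (sqrt p) ^ n * \<zeta> ^ j" by metis
  qed
  from bchoice[OF this] obtain j where j: "\<And>u. u \<in> Zvec p n \<Longrightarrow>
      \<exists>s\<in>{1, -1}. walsh_sum n F u = s * epsilon n * of_real (sqrt p) ^ n * \<zeta> ^ j u" by blast
  define G where "G = (\<lambda>u\<in>Zvec p n. int (j u mod N))"
  have "int (j u mod N) < int p ^ k" for u
    unfolding of_nat_power[symmetric] of_nat_less_iff N_def using p_gt_2 by simp
  hence "G \<in> GB p n k" by (simp add: GB_iff G_def)
  moreover have "\<zeta> powi G u = \<zeta> ^ j u" if "u \<in> Zvec p n" for u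
    using that by (simp add: G_def power_mod_root_of_unity power_int_of_nat del: of_nat_mod)
  ultimately have "is_dual p n k F G" using j by (simp add: is_dual_iff)
  thus ?thesis by (rule that)
qed

text \<open>
  \<open>-1\<close> is not a power of \<open>\<zeta>\<close> because \<open>N\<close> is odd.
\<close>
lemma zeta_power_eq_up_to_sign:
  assumes "s \<in> {1, -1}" "\<zeta> ^ i = s * \<zeta> ^ j" "i < N" "j < N"
  shows "i = j"
proof -
  have "(\<zeta> ^ i) ^ N = 1" "(\<zeta> ^ j) ^ N = 1"
    by (metis power_mult mult.commute zeta_power_N power_one)+
  hence "s ^ N = 1" using assms(2) by (simp add: power_mult_distrib)
  hence "s = 1" using assms(1) odd_N by auto
  thus ?thesis using assms inj_onD[OF zeta_power_inj[of N], of i j] by (simp add: \<zeta>_def)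
qed

text \<open>
  Uniqueness of the dual, in the form in which duals are computed below.
\<close>
lemma dual_eqI:
  assumes G: "is_dual p n k F G"
  shows "dual p n k F = G"
  unfolding dual_def
proof (rule the_equality[of "is_dual p n k F", OF G])
  fix G' assume G': "is_dual p n k F G'"
  show "G' = G"
  proof (rule extensionalityI)
    show "G' \<in> extensional (Zvec p n)" "G \<in> extensional (Zvec p n)"
      using G G' by (auto simp: is_dual_def GB_iff)
    fix u assume u: "u \<in> Zvec p n"
    define g g' where "g = nat (G u)" and "g' = nat (G' u)"
    have range: "0 \<le> G u" "G u < int p ^ k" "0 \<le> G' u" "G' u < int p ^ k"
      using G G' u by (auto simp: is_dual_def GB_iff)
    hence g: "G u = int g" "g < N" "G' u = int g'" "g' < N"
      by (auto simp: g_def g'_def N_def nat_less_iff)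
    obtain s where s: "s \<in> {1, -1}" "walsh_sum n F u = s * epsilon n * of_real (sqrt p) ^ n * \<zeta> powi G u"
      using G u unfolding is_dual_iff by blast
    obtain s' where s': "s' \<in> {1, -1}" "walsh_sum n F u = s' * epsilon n * of_real (sqrt p) ^ n * \<zeta> powi G' u"
      using G' u unfolding is_dual_iff by blast
    have "(epsilon n * of_real (sqrt p) ^ n) * (s * \<zeta> ^ g) = (epsilon n * of_real (sqrt p) ^ n) * (s' * \<zeta> ^ g')"
    proof -
      have "(epsilon n * of_real (sqrt p) ^ n) * (s * \<zeta> ^ g) = walsh_sum n F u"
        unfolding s(2) g(1) by (simp add: mult_ac)
      also have "\<dots> = (epsilon n * of_real (sqrt p) ^ n) * (s' * \<zeta> ^ g')"
        unfolding s'(2) g(3) by (simp add: mult_ac)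
      finally show ?thesis .
    qed
    hence "s * \<zeta> ^ g = s' * \<zeta> ^ g'" using epsilon_nonzero sqrt_power_nonzero p_gt_2 by auto
    hence "s * (s * \<zeta> ^ g) = s * (s' * \<zeta> ^ g')" by simp
    moreover have "s * s = 1" using s(1) by auto
    ultimately have "\<zeta> ^ g = (s * s') * \<zeta> ^ g'" by (simp flip: mult.assoc)
    moreover have "s * s' \<in> {1, -1}" using s(1) s'(1) by auto
    ultimately show "G' u = G u" using g zeta_power_eq_up_to_sign by metis
  qed
qed

lemma powi_zeta_split: "\<zeta> powi m = \<zeta> ^ nat (m mod int q) * \<omega> powi (m div int q)"
proof -
  have z: "\<zeta> \<noteq> 0" by (simp add: \<zeta>_def)
  have "\<zeta> powi m = \<zeta> powi (m mod int q + int q * (m div int q))" by simp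
  also have "\<dots> = \<zeta> powi (m mod int q) * \<omega> powi (m div int q)"
    using z by (subst power_int_add) (simp_all add: power_int_mult zeta_power_q)
  also have "\<zeta> powi (m mod int q) = \<zeta> ^ nat (m mod int q)"
    by (simp add: power_int_def)
  finally show ?thesis .
qed

lemma powi_omega_mod: "\<omega> powi (m mod int p) = \<omega> powi m"
proof -
  have z: "\<omega> \<noteq> 0" by (simp add: \<omega>_def)
  have "\<omega> powi m = \<omega> powi (m mod int p + int p * (m div int p))" by simp
  also have "\<dots> = \<omega> powi (m mod int p)"
    using z by (subst power_int_add) (simp_all add: power_int_mult)
  finally show ?thesis ..
qed

text \<open>
  For \<open>F = q * h + r\<close> with \<open>0 \<le> r < q\<close> this is \<open>h + e(r)\<close> modulo \<open>p\<close>. The component functions of \<open>F\<close> are the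
  case that \<open>e\<close> is a linear combination of the base \<open>p\<close> digits of \<open>r\<close>.
\<close>
definition component :: "nat \<Rightarrow> (int \<Rightarrow> int) \<Rightarrow> ((nat \<Rightarrow> int) \<Rightarrow> int) \<Rightarrow> (nat \<Rightarrow> int) \<Rightarrow> int" where
  "component n e F = (\<lambda>x\<in>Zvec p n. (F x div int q + e (F x mod int q)) mod int p)"

lemma component_in_GB: "component n e F \<in> GB p n 1"
  using p_gt_2 by (auto simp: GB_iff component_def)

text \<open>
  Taking duals commutes with taking components: the Walsh sums of \<open>F\<close> and of all its components at \<open>u\<close> are
  combinations of the same partial sums, over the classes \<open>F mod q = d\<close>. Independence over \<open>\<int>[\<omega>]\<close> recovers
  these partial sums from the single value of the Walsh sum of \<open>F\<close>.
\<close>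
lemma dual_component:
  assumes G: "is_dual p n k F G"
  shows "is_dual p n 1 (component n e F) (component n e G)"
proof -
  interpret P: odd_prime_power p 1 by unfold_locales (use prime_p odd_p in auto)
  have P_zeta: "P.\<zeta> = \<omega>"
    unfolding P.\<zeta>_def P.N_def \<omega>_def by simp
  have w: "\<omega> \<noteq> 0" by (simp add: \<omega>_def)
  obtain \<eta> where \<eta>: "\<eta> \<in> Zadj \<omega>" "\<And>n. \<exists>s\<in>{1, -1}. \<eta> ^ n = s * epsilon n * of_real (sqrt p) ^ n"
    using sqrt_p_star_power by blast
  obtain s' where s': "s' \<in> {1, -1}" "\<eta> ^ n = s' * epsilon n * of_real (sqrt p) ^ n" using \<eta>(2) by blast
  have "\<exists>s\<in>{1, -1}. P.walsh_sum n (component n e F) u =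
      s * epsilon n * of_real (sqrt p) ^ n * \<omega> powi component n e G u" if u: "u \<in> Zvec p n" for u
  proof -
    obtain s where s: "s \<in> {1, -1}" "walsh_sum n F u = s * epsilon n * of_real (sqrt p) ^ n * \<zeta> powi G u"
      using G u unfolding is_dual_iff by blast
    define A where "A = s * epsilon n * of_real (sqrt p) ^ n"
    \<comment> \<open>\<open>A\<close> is the Walsh sum without its root of unity; via \<open>\<eta>\<close> it lies in \<open>\<int>[\<omega>]\<close>\<close>
    have "A = s * s' * \<eta> ^ n" using s'(1) by (auto simp: A_def s'(2))
    moreover have "s * s' \<in> Zadj \<omega>" using s(1) s'(1) by auto
    ultimately have A: "A \<in> Zadj \<omega>" using \<eta>(1) by auto
    define X where "X d = {x \<in> Zvec p n. nat (F x mod int q) = d}" for d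
    define ch where "ch x = \<omega> powi (- (\<Sum>i<n. u i * x i)) * \<omega> powi (F x div int q)" for x
    define T where "T d = (\<Sum>x\<in>X d. ch x)" for d
    define g b where "g = nat (G u mod int q)" and "b = G u div int q"
    have group: "(\<Sum>d<q. \<Sum>x\<in>X d. h x) = (\<Sum>x\<in>Zvec p n. h x)" for h :: "(nat \<Rightarrow> int) \<Rightarrow> complex"
      unfolding X_def by (rule sum.group) (auto simp: nat_less_iff)
    have g: "g < q" by (auto simp: g_def nat_less_iff)
    have "(\<Sum>d<q. \<zeta> ^ d * T d) = (\<Sum>d<q. \<Sum>x\<in>X d. \<omega> powi (- (\<Sum>i<n. u i * x i)) * \<zeta> powi F x)"
      unfolding T_def sum_distrib_left
      by (intro sum.cong refl) (auto simp: X_def ch_def powi_zeta_split[of "F _"])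
    also have "\<dots> = A * \<zeta> powi G u" unfolding group A_def using s(2) by (simp add: walsh_sum_def)
    also have "\<dots> = \<zeta> ^ g * (A * \<omega> powi b)"
      unfolding powi_zeta_split[of "G u"] g_def b_def by (simp only: mult_ac)
    also have "\<dots> = (\<Sum>d<q. if d = g then \<zeta> ^ g * (A * \<omega> powi b) else 0)"
      using g by (simp add: sum.delta)
    also have "\<dots> = (\<Sum>d<q. \<zeta> ^ d * (if d = g then A * \<omega> powi b else 0))"
      by (intro sum.cong refl) auto
    finally have "(\<Sum>d<q. \<zeta> ^ d * (T d - (if d = g then A * \<omega> powi b else 0))) = 0"
      by (simp only: right_diff_distrib sum_subtractf diff_self)
    moreover have "T d - (if d = g then A * \<omega> powi b else 0) \<in> Zadj \<omega>" for d
      using A unfolding T_def ch_def by (auto intro!: Zadj_diff Zadj_sum Zadj_mult)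
    ultimately have "T d - (if d = g then A * \<omega> powi b else 0) = 0" if "d < q" for d
      using zeta_powers_independent_over_omega[of "\<lambda>d. T d - (if d = g then A * \<omega> powi b else 0)"] that by blast
    hence T: "T d = (if d = g then A * \<omega> powi b else 0)" if "d < q" for d
      using that by (simp only: right_minus_eq)
    have "P.walsh_sum n (component n e F) u =
        (\<Sum>x\<in>Zvec p n. ch x * \<omega> powi e (F x mod int q))"
      unfolding P.walsh_sum_def P_zeta
      by (intro sum.cong refl) (simp add: component_def powi_omega_mod ch_def power_int_add w mult_ac)
    also have "\<dots> = (\<Sum>d<q. \<omega> powi e (int d) * T d)"
      unfolding group[symmetric] T_def sum_distrib_left
      by (intro sum.cong refl) (auto simp: X_def mult_ac)
    also have "\<dots> = (\<Sum>d<q. if d = g then \<omega> powi e (int g) * (A * \<omega> powi b) else 0)"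
      by (intro sum.cong refl) (auto simp: T)
    also have "\<dots> = A * \<omega> powi component n e G u"
      using g u by (simp add: sum.delta component_def powi_omega_mod power_int_add w g_def b_def mult_ac)
    finally show ?thesis using s(1) by (auto simp: A_def)
  qed
  thus ?thesis unfolding P.is_dual_iff P_zeta using component_in_GB by blast
qed

end

section \<open>Base b digits of integers\<close>

lemma div_power_mod_add:
  fixes x b y :: int
  assumes "b > 0" "j < l"
  shows "(x + b ^ l * y) div b ^ j mod b = x div b ^ j mod b"
proof -
  have "b ^ l = b ^ j * (b * b ^ (l - j - 1))"
    using assms(2) by (simp flip: power_add power_Suc)
  hence "(x + b ^ l * y) div b ^ j = x div b ^ j + b * (b ^ (l - j - 1) * y)"
    using assms(1) by (simp add: mult.assoc)
  thus ?thesis by simp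
qed

lemma digit_sum_less:
  fixes b :: int
  assumes "b > 0" "\<And>i. i < k \<Longrightarrow> 0 \<le> a i \<and> a i < b"
  shows "0 \<le> (\<Sum>i<k. b ^ i * a i) \<and> (\<Sum>i<k. b ^ i * a i) < b ^ k"
  using assms(2)
proof (induction k)
  case (Suc k)
  have "b ^ k * (a k + 1) \<le> b ^ k * b" using Suc.prems[of k] assms(1) by (intro mult_left_mono) auto
  moreover have "0 \<le> b ^ k * a k" using Suc.prems[of k] assms(1) by auto
  ultimately show ?case using Suc by (auto simp: algebra_simps)
qed auto

lemma digit_of_digit_sum:
  fixes b :: int
  assumes "b > 0" "\<And>i. i < k \<Longrightarrow> 0 \<le> a i \<and> a i < b" "j < k"
  shows "(\<Sum>i<k. b ^ i * a i) div b ^ j mod b = a j"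
  using assms(2,3)
proof (induction k)
  case (Suc k)
  show ?case
  proof (cases "j = k")
    case True
    have "0 \<le> (\<Sum>i<k. b ^ i * a i) \<and> (\<Sum>i<k. b ^ i * a i) < b ^ k"
      using Suc.prems assms(1) by (intro digit_sum_less) auto
    thus ?thesis using True Suc.prems(1)[of k] assms(1) by (simp add: div_pos_pos_trivial)
  next
    case False
    thus ?thesis using Suc assms(1) by (simp add: div_power_mod_add)
  qed
qed auto

lemma sum_digits:
  fixes b x :: int
  assumes "b > 0"
  shows "(\<Sum>i<k. b ^ i * (x div b ^ i mod b)) = x mod b ^ k"
proof (induction k)
  case (Suc k)
  have "x mod b ^ Suc k = x mod (b ^ k * b)" by (simp add: mult.commute)
  also have "\<dots> = b ^ k * (x div b ^ k mod b) + x mod b ^ k"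
    using assms by (intro zmod_zmult2_eq) auto
  finally show ?case using Suc by simp
qed auto

section \<open>The dual in terms of component functions\<close>

theorem theorem5p1:
  fixes p n k :: nat
    and f :: "(nat \<Rightarrow> int) \<Rightarrow> int"
    and a b :: "nat \<Rightarrow> (nat \<Rightarrow> int) \<Rightarrow> int"
  assumes "prime p" and "odd p" and "n \<ge> 1" and "k \<ge> 1"
    and "gbent p n k f"
    and "\<And>i. i < k \<Longrightarrow> a i \<in> GB p n 1"
    and "\<And>x. x \<in> Zvec p n \<Longrightarrow> f x = (\<Sum>i<k. int p ^ i * a i x)"
    and "\<And>x. x \<in> Zvec p n \<Longrightarrow> b (k - 1) x = dual p n 1 (a (k - 1)) x"
    and "\<And>j x. j < k - 1 \<Longrightarrow> x \<in> Zvec p n \<Longrightarrow>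
           b j x = dual p n 1 (\<lambda>y\<in>Zvec p n. a (k - 1) y \<oplus>\<^bsub>residue_ring (int p)\<^esub> a j y) x
             \<ominus>\<^bsub>residue_ring (int p)\<^esub> dual p n 1 (a (k - 1)) x"
  shows "\<forall>x\<in>Zvec p n. dual p n k f x = (\<Sum>i<k. int p ^ i * b i x)"
proof
  fix x assume x: "x \<in> Zvec p n"
  interpret K: odd_prime_power p k by unfold_locales fact+
  interpret P: odd_prime_power p 1 by unfold_locales (use assms in auto)
  interpret R: residues "int p" "residue_ring (int p)"
    by unfold_locales (use K.p_gt_2 in auto)
  have p0: "int p > 0" using K.p_gt_2 by simp
  obtain G where G: "is_dual p n k f G" using K.gbent_has_dual[OF assms(5)] .
  have G_range: "0 \<le> G x" "G x < int p ^ k" using G x by (auto simp: is_dual_def GB_iff)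
  have a_range: "0 \<le> a i y \<and> a i y < int p" if "i < k" "y \<in> Zvec p n" for i y
    using assms(6)[OF that(1)] that(2) by (auto simp: GB_iff)
  have q: "int K.q = int p ^ (k - 1)" by (simp add: K.q_def)
  \<comment> \<open>the weight of a component is evaluated at the residue modulo \<open>q\<close>, which has the same lower digits\<close>
  have low_digit: "y mod int K.q div int p ^ j mod int p = y div int p ^ j mod int p" if "j < k - 1" for y j
    using div_power_mod_add[OF p0 that, of "y mod int K.q" "y div int K.q"] by (simp add: q)
  have a_digit: "f y div int p ^ j mod int p = a j y" if "y \<in> Zvec p n" "j < k" for y j
    using digit_of_digit_sum[OF p0, of k "\<lambda>i. a i y" j] a_range that by (simp add: assms(7))
  define d where "d j y = y div int p ^ j mod int p" for j and y :: int
  have top: "K.component n (\<lambda>_. 0) f = a (k - 1)"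
  proof (rule extensionalityI)
    show "a (k - 1) \<in> extensional (Zvec p n)" using assms(4,6) by (simp add: GB_iff)
  qed (use assms(4) in \<open>auto simp: K.component_def q a_digit\<close>)
  have mid: "K.component n (d j) f = (\<lambda>y\<in>Zvec p n. a (k - 1) y \<oplus>\<^bsub>residue_ring (int p)\<^esub> a j y)"
    if "j < k - 1" for j
    unfolding K.component_def
  proof (intro restrict_ext)
    fix y assume y: "y \<in> Zvec p n"
    have "(f y div int K.q + d j (f y mod int K.q)) mod int p =
        (f y div int p ^ (k - 1) mod int p + d j (f y)) mod int p"
      using low_digit[OF that] by (simp add: d_def q mod_simps)
    thus "(f y div int K.q + d j (f y mod int K.q)) mod int p =
        a (k - 1) y \<oplus>\<^bsub>residue_ring (int p)\<^esub> a j y"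
      using y that assms(4) by (simp add: R.res_add_eq d_def a_digit)
  qed
  have dual_top: "dual p n 1 (a (k - 1)) = K.component n (\<lambda>_. 0) G"
    using P.dual_eqI[OF K.dual_component[OF G]] unfolding top[symmetric] .
  have dual_mid: "dual p n 1 (\<lambda>y\<in>Zvec p n. a (k - 1) y \<oplus>\<^bsub>residue_ring (int p)\<^esub> a j y) =
      K.component n (d j) G" if "j < k - 1" for j
    using P.dual_eqI[OF K.dual_component[OF G]] unfolding mid[OF that, symmetric] .
  have b_digit: "b j x = d j (G x)" if "j < k" for j
  proof (cases "j = k - 1")
    case True
    thus ?thesis
      using x assms(8)[OF x] unfolding dual_top by (simp add: K.component_def q d_def)
  next
    case False
    hence j: "j < k - 1" using that by simp
    have "b j x = ((G x div int K.q + d j (G x mod int K.q)) mod int p - G x div int K.q mod int p) mod int p"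
      using x assms(9)[OF j x] unfolding dual_top dual_mid[OF j]
      by (simp add: K.component_def a_minus_def R.res_add_eq R.res_neg_eq mod_simps)
    also have "\<dots> = d j (G x mod int K.q) mod int p" by (simp add: mod_simps)
    also have "\<dots> = d j (G x)" using low_digit[OF j] by (simp add: d_def)
    finally show ?thesis .
  qed
  have "dual p n k f x = G x" using K.dual_eqI[OF G] by simp
  also have "\<dots> = G x mod int p ^ k" using G_range by simp
  also have "\<dots> = (\<Sum>i<k. int p ^ i * (G x div int p ^ i mod int p))"
    using sum_digits[OF p0] by simp
  also have "\<dots> = (\<Sum>i<k. int p ^ i * b i x)"
    by (intro sum.cong refl) (simp add: b_digit d_def)
  finally show "dual p n k f x = (\<Sum>i<k. int p ^ i * b i x)" .
qed

end
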